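(* Let $X\subset\mathbb{R}^n$ and $Y\subset\mathbb{R}^m$ be real algebraic varieties and let $f:X\to Y$ be an algebraic morphism, given by an $m$-tuple of polynomials in $\mathbb{R}[x_1,\dots,x_n]$. Let $X(\mathbb{C})$, $Y(\mathbb{C})$ be the complex varieties defined by the same real polynomials that define $X$ and $Y$, and let $f_{\mathbb{C}}:X(\mathbb{C})\to Y(\mathbb{C})$ be the morphism of complex varieties given by the same $m$-tuple as $f$ (it is assumed that this tuple maps $X(\mathbb{C})$ into $Y(\mathbb{C})$). Let $I_\bullet$ and $J_\bullet$ be descending chains of radical ideals in $\mathbb{R}[x_1,\dots,x_n]$ and $\mathbb{R}[y_1,\dots,y_m]$, respectively, such that the flags of complex zero loci $X_\bullet(\mathbb{C}):=\mathbf{V}_{\mathbb{C}}(I_\bullet)$ and $Y_\bullet(\mathbb{C}):=\mathbf{V}_{\mathbb{C}}(J_\bullet)$ are Whitney stratifications of $X(\mathbb{C})$ and $Y(\mathbb{C})$; let $X_\bullet:=\mathbf{V}(I_\bullet)$ and $Y_\bullet:=\mathbf{V}(J_\bullet)$ be the flags of real zero loci, which are Whitney stratifications of $X$ and $Y$. If $f_{\mathbb{C}}$ is stratified with respect to $X_\bullet(\mathbb{C})$ and $Y_\bullet(\mathbb{C})$, then $f$ is stratified with respect to $X_\bullet$ and $Y_\bullet$.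
   Context: Zero loci: for an ideal $I\subset\mathbb{R}[x_1,\dots,x_n]$, $\mathbf{V}(I)\subset\mathbb{R}^n$ and $\mathbf{V}_{\mathbb{C}}(I)\subset\mathbb{C}^n$ are its sets of real and complex zeros. Condition (B): a pair $(M,N)$ of smooth submanifolds of $\mathbb{R}^n$ satisfies Whitney's Condition (B) if for every $q\in N$ and all sequences $\{p_k\}\subset M$, $\{q_k\}\subset N$ with $\lim p_k=q=\lim q_k$, whenever $T=\lim T_{p_k}M$ and the limiting secant line $\ell=\lim[p_k,q_k]$ both exist, one has $\ell\subset T$. For submanifolds of $\mathbb{C}^n$ use $\mathbb{C}^n\cong\mathbb{R}^{2n}$. A Whitney stratification of a set is a locally finite decomposition into smooth connected nonempty manifolds (strata) such that every pair of strata satisfies Condition (B). For a (real or complex) variety $X$, a flag of subvarieties $\varnothing=X_{-1}\subset X_0\subset\cdots\subset X_k=X$ is called a Whitney stratification if each $X_i-X_{i-1}$ is empty or a smooth manifold of (real, resp. complex) dimension $i$, and the connected components of these differences are the strata of a Whitney stratification. Stratified map: a continuous map $\phi:\mathscr{X}\to\mathscr{Y}$ is stratified with respect to Whitney stratifications $\mathscr{X}_\bullet$ and $\mathscr{Y}_\bullet$ if for each stratum $M\subset\mathscr{X}$ there is a stratum $N\subset\mathscr{Y}$ such that (1) $\phi(M)\subset N$, and (2) $\phi|_M:M\to N$ is a smooth submersion, i.e. its derivative $T_xM\to T_{\phi(x)}N$ is surjective at every $x\in M$. *)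

theory Defs
  imports "HOL-Analysis.Analysis" "HOL-Library.Poly_Mapping" "HOL-Library.Disjoint_Sets"
begin

section \<open>Polynomials in finitely many variables, ideals, zero loci\<close>

text \<open>
  The variables are indexed by a finite type \<open>'n\<close>.  A monomial is a finitely supported exponent
  function, a polynomial a finitely supported coefficient function on monomials; the ring structure
  (convolution product) is the one of \<^theory>\<open>HOL-Library.Poly_Mapping\<close>.
\<close>

type_synonym ('n, 'a) mpoly = "('n \<Rightarrow>\<^sub>0 nat) \<Rightarrow>\<^sub>0 'a"

definition poly_eval :: "('n::finite, 'a::comm_ring_1) mpoly \<Rightarrow> 'a ^ 'n \<Rightarrow> 'a" where
  "poly_eval p x =
     (\<Sum>m \<in> Poly_Mapping.keys p.
        Poly_Mapping.lookup p m * (\<Prod>i\<in>UNIV. x $ i ^ Poly_Mapping.lookup m i))"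

definition complexify :: "('n, real) mpoly \<Rightarrow> ('n, complex) mpoly" where
  "complexify p = Poly_Mapping.map complex_of_real p"

definition zero_locus :: "('n::finite, 'a::comm_ring_1) mpoly set \<Rightarrow> ('a ^ 'n) set" where
  "zero_locus P = {x. \<forall>p\<in>P. poly_eval p x = 0}"

definition complex_zero_locus :: "('n::finite, real) mpoly set \<Rightarrow> (complex ^ 'n) set" where
  "complex_zero_locus P = zero_locus (complexify ` P)"

definition algebraic_set :: "('a::comm_ring_1 ^ 'n::finite) set \<Rightarrow> bool" where
  "algebraic_set X \<longleftrightarrow> (\<exists>P. X = zero_locus P)"

text \<open>
  The unit ideal counts as radical: it is the only radical ideal without complex zeros, and is
  needed for the empty members of a flag.
\<close>

definition radical_ideal :: "'r::comm_ring_1 set \<Rightarrow> bool" where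
  "radical_ideal I \<longleftrightarrow>
     0 \<in> I \<and> (\<forall>a\<in>I. \<forall>b\<in>I. a + b \<in> I) \<and> (\<forall>r. \<forall>a\<in>I. r * a \<in> I) \<and>
     (\<forall>a n. a ^ n \<in> I \<longrightarrow> a \<in> I)"

definition poly_map ::
    "('n::finite, 'a::comm_ring_1) mpoly ^ 'm \<Rightarrow> 'a ^ 'n \<Rightarrow> 'a ^ 'm" where
  "poly_map f x = (\<chi> j. poly_eval (f $ j) x)"

definition complex_poly_map ::
    "('n::finite, real) mpoly ^ 'm \<Rightarrow> complex ^ 'n \<Rightarrow> complex ^ 'm" where
  "complex_poly_map f = poly_map (\<chi> j. complexify (f $ j))"


section \<open>Smooth and complex submanifolds, tangent spaces\<close>

text \<open>
  \<open>Ck_on k U f\<close>, for open \<open>U\<close>: all iterated directional derivatives of \<open>f\<close> of order at most \<open>k\<close>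
  exist and are continuous on \<open>U\<close>.
\<close>

primrec Ck_on ::
    "nat \<Rightarrow> 'a::real_normed_vector set \<Rightarrow> ('a \<Rightarrow> 'b::real_normed_vector) \<Rightarrow> bool" where
  "Ck_on 0 U f \<longleftrightarrow> continuous_on U f"
| "Ck_on (Suc k) U f \<longleftrightarrow>
     (\<forall>x\<in>U. f differentiable (at x)) \<and> (\<forall>v. Ck_on k U (\<lambda>x. frechet_derivative f (at x) v))"

definition smooth_on ::
    "'a::real_normed_vector set \<Rightarrow> ('a \<Rightarrow> 'b::real_normed_vector) \<Rightarrow> bool" where
  "smooth_on U f \<longleftrightarrow> (\<forall>k. Ck_on k U f)"

text \<open>
  Submanifolds are given by slice charts of the ambient space: a diffeomorphism (respectively a
  biholomorphic map) between open sets that straightens \<open>M\<close> to a \<open>d\<close>-dimensional linear subspace.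
  The empty set is a submanifold of every dimension.
\<close>

definition smooth_submanifold :: "nat \<Rightarrow> 'a::euclidean_space set \<Rightarrow> bool" where
  "smooth_submanifold d M \<longleftrightarrow>
     (\<forall>p\<in>M. \<exists>U (V :: 'a set) \<phi> \<psi> L.
        open U \<and> p \<in> U \<and> open V \<and> homeomorphism U V \<phi> \<psi> \<and> smooth_on U \<phi> \<and> smooth_on V \<psi> \<and>
        subspace L \<and> dim L = d \<and> \<phi> ` (M \<inter> U) = L \<inter> V)"

definition complex_differentiable_on ::
    "(complex ^ 'n::finite) set \<Rightarrow> (complex ^ 'n \<Rightarrow> complex ^ 'm::finite) \<Rightarrow> bool" where
  "complex_differentiable_on U f \<longleftrightarrow>
     (\<forall>z\<in>U. \<exists>D. (f has_derivative D) (at z) \<and> (\<forall>c v. D (c *s v) = c *s D v))"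

text \<open>
  Here \<open>d\<close> is the complex dimension; \<open>vec.subspace\<close> and \<open>vec.dim\<close> refer to the complex vector
  space structure.
\<close>

definition complex_submanifold :: "nat \<Rightarrow> (complex ^ 'n::finite) set \<Rightarrow> bool" where
  "complex_submanifold d M \<longleftrightarrow>
     (\<forall>p\<in>M. \<exists>U (V :: (complex ^ 'n) set) \<phi> \<psi> L.
        open U \<and> p \<in> U \<and> open V \<and> homeomorphism U V \<phi> \<psi> \<and>
        complex_differentiable_on U \<phi> \<and> complex_differentiable_on V \<psi> \<and>
        vec.subspace L \<and> vec.dim L = d \<and> \<phi> ` (M \<inter> U) = L \<inter> V)"

text \<open>
  The tangent space is the set of velocities of smooth curves in \<open>M\<close>, as a subspace through the
  origin.  For \<open>M\<close> in complex space this is the tangent space under \<open>\<complex>\<^sup>n \<cong> \<real>\<^sup>2\<^sup>n\<close>, since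
  \<open>complex ^ 'n\<close> is a (real) Euclidean space.
\<close>

definition tangent_space :: "'a::euclidean_space set \<Rightarrow> 'a \<Rightarrow> 'a set" where
  "tangent_space M p =
     {v. \<exists>\<gamma> \<epsilon>. (\<epsilon>::real) > 0 \<and> smooth_on {-\<epsilon><..<\<epsilon>} \<gamma> \<and> \<gamma> ` {-\<epsilon><..<\<epsilon>} \<subseteq> M \<and> \<gamma> 0 = p \<and>
           (\<gamma> has_vector_derivative v) (at 0)}"


section \<open>Condition (B) and Whitney stratifications\<close>

text \<open>
  Convergence of linear subspaces in the Grassmannian, i.e. convergence of the orthogonal
  projections; for a subspace \<open>S\<close>, the map \<open>closest_point S\<close> is the orthogonal projection to \<open>S\<close>.
  (In finite dimension pointwise convergence of the projections is norm convergence, so the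
  dimension of \<open>S k\<close> is eventually that of \<open>T\<close>.)
\<close>

definition subspace_tendsto :: "(nat \<Rightarrow> 'a::euclidean_space set) \<Rightarrow> 'a set \<Rightarrow> bool" where
  "subspace_tendsto S T \<longleftrightarrow>
     subspace T \<and> (\<forall>x. (\<lambda>k. closest_point (S k) x) \<longlonglongrightarrow> closest_point T x)"

text \<open>
  The secant line \<open>[p k, q k]\<close>, translated to the origin, is \<open>span {p k - q k}\<close>; it is defined
  only if \<open>p k \<noteq> q k\<close>.
\<close>

definition condition_B :: "'a::euclidean_space set \<Rightarrow> 'a set \<Rightarrow> bool" where
  "condition_B M N \<longleftrightarrow>
     (\<forall>p q a T l.
        a \<in> N \<and> (\<forall>k. p k \<in> M \<and> q k \<in> N \<and> p k \<noteq> q k) \<and>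
        p \<longlonglongrightarrow> a \<and> q \<longlonglongrightarrow> a \<and>
        subspace_tendsto (\<lambda>k. tangent_space M (p k)) T \<and>
        subspace_tendsto (\<lambda>k. span {p k - q k}) l
        \<longrightarrow> l \<subseteq> T)"

definition whitney_stratification ::
    "'a::euclidean_space set \<Rightarrow> 'a set set \<Rightarrow> bool" where
  "whitney_stratification X \<S> \<longleftrightarrow>
     \<Union>\<S> = X \<and> disjoint \<S> \<and> locally_finite_in (top_of_set X) \<S> \<and>
     (\<forall>M\<in>\<S>. M \<noteq> {} \<and> connected M \<and> (\<exists>d. smooth_submanifold d M)) \<and>
     (\<forall>M\<in>\<S>. \<forall>N\<in>\<S>. condition_B M N)"

text \<open>Flags are indexed by the integers \<open>-1, \<dots>, k\<close>.\<close>

definition flag_strata ::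
    "int \<Rightarrow> (int \<Rightarrow> 'a::topological_space set) \<Rightarrow> 'a set set" where
  "flag_strata k F = (\<Union>i\<in>{0..k}. components (F i - F (i - 1)))"

definition complex_whitney_flag ::
    "int \<Rightarrow> (int \<Rightarrow> (complex ^ 'n::finite) set) \<Rightarrow> (complex ^ 'n) set \<Rightarrow> bool" where
  "complex_whitney_flag k F X \<longleftrightarrow>
     -1 \<le> k \<and> F (-1) = {} \<and> F k = X \<and>
     (\<forall>i\<in>{-1..k}. algebraic_set (F i)) \<and>
     (\<forall>i\<in>{0..k}. F (i - 1) \<subseteq> F i \<and>
        (F i - F (i - 1) = {} \<or> complex_submanifold (nat i) (F i - F (i - 1)))) \<and>
     whitney_stratification X (flag_strata k F)"


section \<open>Stratified maps\<close>

text \<open>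
  Smoothness of \<open>f\<close> on \<open>M\<close> means that \<open>f\<close> locally extends to a smooth map \<open>g\<close> of the ambient
  space; the derivative of \<open>f\<close> restricted to \<open>M\<close> at \<open>x\<close> is the restriction of the derivative of
  \<open>g\<close> to the tangent space of \<open>M\<close>.
\<close>

definition smooth_submersion ::
    "'a::euclidean_space set \<Rightarrow> 'b::euclidean_space set \<Rightarrow> ('a \<Rightarrow> 'b) \<Rightarrow> bool" where
  "smooth_submersion M N f \<longleftrightarrow>
     (\<exists>d. smooth_submanifold d M) \<and> (\<exists>e. smooth_submanifold e N) \<and> f ` M \<subseteq> N \<and>
     (\<forall>x\<in>M. \<exists>U g D. open U \<and> x \<in> U \<and> smooth_on U g \<and> (\<forall>y\<in>M \<inter> U. g y = f y) \<and>
        (g has_derivative D) (at x) \<and> D ` tangent_space M x = tangent_space N (f x))"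

definition stratified_map ::
    "'a::euclidean_space set \<Rightarrow> 'a set set \<Rightarrow> 'b::euclidean_space set \<Rightarrow> 'b set set \<Rightarrow>
     ('a \<Rightarrow> 'b) \<Rightarrow> bool" where
  "stratified_map X \<S> Y \<T> f \<longleftrightarrow>
     continuous_on X f \<and> f ` X \<subseteq> Y \<and>
     (\<forall>M\<in>\<S>. \<exists>N\<in>\<T>. f ` M \<subseteq> N \<and> smooth_submersion M N f)"

end

theory Submission
  imports Defs "HOL-Complex_Analysis.Cauchy_Integral_Formula"
begin

text \<open>
  A conjugation-invariant complex submanifold \<open>Z\<close> of dimension \<open>d\<close> is, near a real point \<open>p\<close>, the
  graph of a holomorphic map over \<open>T\<^sub>pZ\<close>, and the projection to \<open>T\<^sub>pZ\<close> can be chosen to commute with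
  conjugation.  The graph map then commutes with conjugation as well, so the real points of \<open>Z\<close> are the
  graph of a smooth map over the real part of \<open>T\<^sub>pZ\<close>: they form a submanifold of real dimension \<open>d\<close>
  whose tangent space at \<open>p\<close> consists of the real vectors of \<open>T\<^sub>pZ\<close>.  Since the derivative of a real
  polynomial map commutes with taking real parts, a real preimage of a real tangent vector is the real part
  of a complex one, so surjectivity on tangent spaces descends.
\<close>

section \<open>Smooth maps\<close>

text \<open>A slice chart of a complex submanifold at a real point need not respect conjugation, so
  it cannot simply be restricted to real points. A graph map is more rigid: a point of the graph is
  recovered from its projection, so symmetry of the manifold and of the projection forces symmetry
  of the graph map. Connected components fit this argument less well, since the real points of one
  complex stratum may fall apart into several real strata. The manifold arguments are therefore made
  for a whole difference of two zero loci, which is invariant under conjugation because its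
  equations are real. Components enter through the locality of charts and tangent spaces, and
  connectedness selects the target stratum. Smoothness in the sense of \<open>smooth_on\<close> asks
  for all iterated derivatives, while the charts in \<open>complex_submanifold\<close> come only
  with a complex linear derivative at each point. Cauchy's formula closes this gap.\<close>

lemma Ck_on_subset: "Ck_on k U f \<Longrightarrow> V \<subseteq> U \<Longrightarrow> Ck_on k V f"
  by (induction k arbitrary: f) (auto intro: continuous_on_subset)

text \<open>At a point of an open set the derivative sees only values inside the set, so the
  derivatives of \<open>f\<close> and \<open>g\<close> agree on \<open>U\<close> and the induction
  can be applied to them.\<close>

lemma Ck_on_cong:
  assumes "open U" "\<And>x. x \<in> U \<Longrightarrow> f x = g x" "Ck_on k U f"
  shows "Ck_on k U g"
  using assms(2,3)
proof (induction k arbitrary: f g)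
  case 0
  then show ?case
    using continuous_on_cong[of U U f g] by simp
next
  case (Suc k)
  have transform: "(g has_derivative D) (at x)" if "(f has_derivative D) (at x)" "x \<in> U" for D x
    using that has_derivative_transform_within_open \<open>open U\<close> Suc.prems(1) by blast
  have deriv: "(g has_derivative frechet_derivative f (at x)) (at x)" if "x \<in> U" for x
    using Suc.prems(2) that by (auto intro!: transform simp: frechet_derivative_works)
  have eq: "frechet_derivative f (at x) = frechet_derivative g (at x)" if "x \<in> U" for x
    using frechet_derivative_at deriv that by blast
  show ?case
    using Suc.prems(2) deriv Suc.IH[where f = "\<lambda>x. frechet_derivative f (at x) v"
        and g = "\<lambda>x. frechet_derivative g (at x) v" for v] eq
    by (auto simp: differentiable_def)
qed

text \<open>Differentiation replaces the direction \<open>v\<close> by the fixed direction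
  \<open>l v\<close>, so the induction stays within the same shape. For a general inner map the
  direction would vary with the point and product terms would appear; the smooth compositions formed
  below all have an affine inner or a linear outer map.\<close>

lemma Ck_on_compose_affine:
  assumes "bounded_linear l" "open U" "Ck_on k U f"
  shows "Ck_on k {x. c + l x \<in> U} (\<lambda>x. f (c + l x))"
  using assms(3)
proof (induction k arbitrary: f)
  case 0
  have "continuous_on {x. c + l x \<in> U} (\<lambda>x. c + l x)"
    by (intro continuous_intros linear_continuous_on assms)
  then show ?case
    using 0 continuous_on_compose2[of U f _ "\<lambda>x. c + l x"] by auto
next
  case (Suc k)
  let ?V = "{x. c + l x \<in> U}"
  have "open ?V"
  proof -
    have "continuous_on UNIV (\<lambda>x. c + l x)"
      by (intro continuous_intros linear_continuous_on assms)
    then show ?thesis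
      using open_vimage[OF \<open>open U\<close>, of "\<lambda>x. c + l x"] by (simp add: vimage_def)
  qed
  have deriv: "((\<lambda>x. f (c + l x)) has_derivative
      (\<lambda>v. frechet_derivative f (at (c + l x)) (l v))) (at x)" if "x \<in> ?V" for x
  proof -
    have "(f has_derivative frechet_derivative f (at (c + l x))) (at (c + l x))"
      using Suc.prems that by (auto simp: frechet_derivative_works)
    moreover have "((\<lambda>x. c + l x) has_derivative l) (at x)"
      using bounded_linear_imp_has_derivative[OF assms(1)]
      by (auto intro!: derivative_eq_intros)
    ultimately show ?thesis
      using has_derivative_compose[of "\<lambda>x. c + l x" l x UNIV f] by blast
  qed
  have "Ck_on k ?V (\<lambda>x. frechet_derivative (\<lambda>x. f (c + l x)) (at x) v)" for v
  proof (rule Ck_on_cong[OF \<open>open ?V\<close>])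
    show "frechet_derivative f (at (c + l x)) (l v) =
        frechet_derivative (\<lambda>x. f (c + l x)) (at x) v" if "x \<in> ?V" for x
      using frechet_derivative_at[OF deriv[OF that]] by metis
    show "Ck_on k ?V (\<lambda>x. frechet_derivative f (at (c + l x)) (l v))"
      using Suc.IH[of "\<lambda>x. frechet_derivative f (at x) (l v)"] Suc.prems by simp
  qed
  then show ?case
    using deriv by (auto simp: differentiable_def)
qed

lemma Ck_on_bounded_linear:
  assumes "bounded_linear B" "open U" "Ck_on k U f"
  shows "Ck_on k U (\<lambda>x. B (f x))"
  using assms(3)
proof (induction k arbitrary: f)
  case 0
  then show ?case
    using bounded_linear.continuous_on[OF assms(1)] by simp
next
  case (Suc k)
  have deriv: "((\<lambda>x. B (f x)) has_derivative (\<lambda>v. B (frechet_derivative f (at x) v))) (at x)"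
    if "x \<in> U" for x
    using Suc.prems that
    by (auto intro!: bounded_linear.has_derivative[OF assms(1)] simp: frechet_derivative_works)
  have "Ck_on k U (\<lambda>x. frechet_derivative (\<lambda>x. B (f x)) (at x) v)" for v
  proof (rule Ck_on_cong[OF \<open>open U\<close>])
    show "B (frechet_derivative f (at x) v) = frechet_derivative (\<lambda>x. B (f x)) (at x) v"
      if "x \<in> U" for x
      using frechet_derivative_at[OF deriv[OF that]] by metis
    show "Ck_on k U (\<lambda>x. B (frechet_derivative f (at x) v))"
      using Suc.IH[of "\<lambda>x. frechet_derivative f (at x) v"] Suc.prems by simp
  qed
  then show ?case
    using deriv by (auto simp: differentiable_def)
qed

lemma Ck_on_const: "Ck_on k U (\<lambda>x. c)"
  by (induction k arbitrary: c) auto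

lemma Ck_on_add:
  assumes "open U" "Ck_on k U f" "Ck_on k U g"
  shows "Ck_on k U (\<lambda>x. f x + g x)"
  using assms(2,3)
proof (induction k arbitrary: f g)
  case 0
  then show ?case
    by (simp add: continuous_on_add)
next
  case (Suc k)
  have deriv: "((\<lambda>x. f x + g x) has_derivative
      (\<lambda>v. frechet_derivative f (at x) v + frechet_derivative g (at x) v)) (at x)" if "x \<in> U" for x
    using Suc.prems that by (auto intro!: has_derivative_add simp: frechet_derivative_works)
  have "Ck_on k U (\<lambda>x. frechet_derivative (\<lambda>x. f x + g x) (at x) v)" for v
  proof (rule Ck_on_cong[OF \<open>open U\<close>])
    show "frechet_derivative f (at x) v + frechet_derivative g (at x) v =
        frechet_derivative (\<lambda>x. f x + g x) (at x) v" if "x \<in> U" for x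
      using frechet_derivative_at[OF deriv[OF that]] by metis
    show "Ck_on k U (\<lambda>x. frechet_derivative f (at x) v + frechet_derivative g (at x) v)"
      using Suc.IH Suc.prems by simp
  qed
  then show ?case
    using deriv by (auto simp: differentiable_def)
qed

lemma smooth_on_subset: "smooth_on U f \<Longrightarrow> V \<subseteq> U \<Longrightarrow> smooth_on V f"
  unfolding smooth_on_def using Ck_on_subset by blast

lemma smooth_on_compose_affine:
  assumes "bounded_linear l" "open U" "smooth_on U f"
  shows "smooth_on {x. c + l x \<in> U} (\<lambda>x. f (c + l x))"
  using assms Ck_on_compose_affine unfolding smooth_on_def by blast

lemma smooth_on_bounded_linear:
  assumes "bounded_linear B" "open U" "smooth_on U f"
  shows "smooth_on U (\<lambda>x. B (f x))"
  using assms Ck_on_bounded_linear unfolding smooth_on_def by blast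

lemma smooth_on_add:
  "open U \<Longrightarrow> smooth_on U f \<Longrightarrow> smooth_on U g \<Longrightarrow> smooth_on U (\<lambda>x. f x + g x)"
  unfolding smooth_on_def using Ck_on_add by blast

lemma smooth_on_affine:
  assumes "bounded_linear l"
  shows "smooth_on U (\<lambda>x. c + l x)"
  unfolding smooth_on_def
proof
  fix k
  have deriv: "((\<lambda>x. c + l x) has_derivative l) (at x)" for x
    using bounded_linear_imp_has_derivative[OF assms] by (auto intro!: derivative_eq_intros)
  show "Ck_on k U (\<lambda>x. c + l x)"
  proof (cases k)
    case 0
    then show ?thesis
      using linear_continuous_on[OF assms] by (simp add: continuous_on_add)
  next
    case (Suc j)
    have "frechet_derivative (\<lambda>x. c + l x) (at x) = l" for x
      using frechet_derivative_at[OF deriv] by metis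
    then show ?thesis
      using deriv Suc by (auto simp: differentiable_def Ck_on_const)
  qed
qed

lemma smooth_on_imp_continuous_on: "smooth_on U f \<Longrightarrow> continuous_on U f"
  unfolding smooth_on_def using Ck_on.simps(1) by blast

section \<open>Holomorphic maps of several variables are smooth\<close>

lemma norm_vector_scalar_mult: "norm (c *s v) = norm c * norm (v :: complex ^ 'n::finite)"
  by (simp add: norm_vec_def norm_mult L2_set_right_distrib)

lemma bounded_linear_vector_scalar_mult: "bounded_linear (\<lambda>c. c *s (v :: complex ^ 'n::finite))"
  by (rule bounded_linear_intro[where K = "norm v"])
     (auto simp: vec_eq_iff algebra_simps norm_vector_scalar_mult)

text \<open>On the complex line through \<open>z\<close> in direction \<open>v\<close> the map
  becomes a holomorphic function \<open>h\<close> of one variable, because complex homogeneity turns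
  the directional derivative into a complex derivative. Cauchy's formula then expresses that
  derivative by values of \<open>f\<close> alone, which is the source of its regularity.\<close>

lemma complex_directional_derivative_integral:
  fixes f :: "complex ^ 'n::finite \<Rightarrow> complex"
  assumes "s > 0"
    and deriv: "\<And>\<zeta>. \<zeta> \<in> cball 0 s \<Longrightarrow> (f has_derivative D \<zeta>) (at (z + \<zeta> *s v))"
    and scal: "\<And>\<zeta> c. \<zeta> \<in> cball 0 s \<Longrightarrow> D \<zeta> (c *s v) = c * D \<zeta> v"
  shows "D 0 v = integral {0..1}
           (\<lambda>t. f (z + circlepath 0 s t *s v) / circlepath 0 s t)"
proof -
  define h where "h \<zeta> = f (z + \<zeta> *s v)" for \<zeta>
  have h: "(h has_field_derivative D \<zeta> v) (at \<zeta>)" if "\<zeta> \<in> cball 0 s" for \<zeta>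
  proof -
    have "((\<lambda>\<zeta>. z + \<zeta> *s v) has_derivative (\<lambda>c. c *s v)) (at \<zeta>)"
      using bounded_linear_imp_has_derivative[OF bounded_linear_vector_scalar_mult]
      by (auto intro!: derivative_eq_intros)
    then have "(h has_derivative (\<lambda>c. D \<zeta> (c *s v))) (at \<zeta>)"
      unfolding h_def using has_derivative_compose deriv[OF that] by blast
    moreover have "(\<lambda>c. D \<zeta> (c *s v)) = (*) (D \<zeta> v)"
      using scal that by auto
    ultimately show ?thesis
      by (simp add: has_field_derivative_def)
  qed
  then have "h holomorphic_on cball 0 s"
    by (meson field_differentiable_at_within field_differentiable_def holomorphic_on_def)
  then have "(h has_field_derivative
      (1 / (2 * of_real pi * \<i>) * contour_integral (circlepath 0 s) (\<lambda>u. h u / (u - 0)^2))) (at 0)"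
    using \<open>s > 0\<close> by (intro Cauchy_derivative_integral_circlepath(2)[where z = 0 and r = s])
      (auto intro: holomorphic_on_imp_continuous_on holomorphic_on_subset)
  then have "D 0 v = 1 / (2 * of_real pi * \<i>) *
      contour_integral (circlepath 0 s) (\<lambda>u. h u / (u - 0)^2)"
    using DERIV_unique h[of 0] \<open>s > 0\<close> by auto
  \<comment> \<open>The parametrization \<open>u = circlepath 0 s t\<close> has derivative
    \<open>2 * pi * \<i> * u\<close>; its factor \<open>u\<close> cancels one power in the Cauchy
    kernel, and its constant will cancel the one in front.\<close>
  also have "\<dots> = 1 / (2 * of_real pi * \<i>) * integral {0..1}
      (\<lambda>t. (2 * of_real pi * \<i>) * (h (circlepath 0 s t) / circlepath 0 s t))"
    unfolding contour_integral_integral vector_derivative_circlepath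
    using \<open>s > 0\<close> by (simp add: circlepath power2_eq_square field_simps)
  also have "\<dots> = integral {0..1} (\<lambda>t. h (circlepath 0 s t) / circlepath 0 s t)"
    by (subst integral_mult_right) auto
  finally show ?thesis
    by (simp add: h_def)
qed

text \<open>
  No continuity of the derivative is assumed: Cauchy's integral formula along the line in direction
  \<open>v\<close> first shows that every directional derivative is continuous, and only then may one differentiate
  under the integral.
\<close>

lemma complex_derivative_has_derivative:
  fixes f :: "complex ^ 'n::finite \<Rightarrow> complex"
  assumes "open U"
    and deriv: "\<And>z. z \<in> U \<Longrightarrow> (f has_derivative D z) (at z)"
    and scal: "\<And>z c v. z \<in> U \<Longrightarrow> D z (c *s v) = c * D z v"
    and "z0 \<in> U"
  shows "\<exists>E. ((\<lambda>z. D z v) has_derivative E) (at z0) \<and> (\<forall>c w. E (c *s w) = c * E w)"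
proof -
  have contf: "continuous_on U f"
    by (intro continuous_at_imp_continuous_on ballI has_derivative_continuous[OF deriv])
  \<comment> \<open>One radius \<open>s\<close> serves all base points near \<open>z1\<close>, so
    the contour does not move with \<open>z\<close> and the Cauchy integral depends on
    \<open>z\<close> only as a parameter.\<close>
  have local: "\<exists>r>0. \<exists>s>0. \<forall>z\<in>ball z1 r. z \<in> U \<and> (\<forall>\<zeta>\<in>cball 0 s. z + \<zeta> *s v \<in> U)"
    if z1: "z1 \<in> U" for z1 v
  proof -
    obtain e where e: "e > 0" "ball z1 e \<subseteq> U"
      using z1 \<open>open U\<close> openE by blast
    \<comment> \<open>The summand 1 keeps \<open>b\<close> positive when
      \<open>v = 0\<close>.\<close>
    define b where "b = 1 + norm v"
    define s where "s = e / 2 / b"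
    have pos: "b > 0"
      using norm_ge_zero[of v] unfolding b_def by linarith
    have "s > 0"
      using e pos by (simp add: s_def)
    have "z + \<zeta> *s v \<in> ball z1 e" if "z \<in> ball z1 (e/2)" "\<zeta> \<in> cball 0 s" for z \<zeta>
    proof -
      have "norm (\<zeta> *s v) \<le> s * norm v"
        using that by (simp add: norm_vector_scalar_mult mult_right_mono)
      also have "s * norm v \<le> s * b"
        using \<open>s > 0\<close> by (simp add: b_def)
      also have "\<dots> = e / 2"
        using pos by (simp add: s_def)
      finally have "norm (\<zeta> *s v) \<le> e / 2" .
      moreover have "dist z1 (z + \<zeta> *s v) \<le> dist z1 z + norm (\<zeta> *s v)"
        using dist_triangle[of z1 "z + \<zeta> *s v" z] by (simp add: dist_norm)
      ultimately show ?thesis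
        using that by simp
    qed
    moreover have "ball z1 (e/2) \<subseteq> U"
      using e subset_ball[of "e/2" e z1] by auto
    ultimately have "z \<in> U \<and> (\<forall>\<zeta>\<in>cball 0 s. z + \<zeta> *s v \<in> U)" if "z \<in> ball z1 (e/2)" for z
      using that e by blast
    then show ?thesis
      using e \<open>s > 0\<close> by (meson half_gt_zero)
  qed
  have circ: "circlepath 0 s t \<in> cball 0 s" "circlepath 0 s t \<noteq> 0" if "s > 0" for s t
    using that by (auto simp: circlepath norm_mult)
  have contc [continuous_intros]: "continuous_on S (\<lambda>x. circlepath 0 s (snd x))"
    for S :: "('b::topological_space \<times> real) set" and s
    unfolding circlepath by (intro continuous_intros)
  have contv [continuous_intros]: "continuous_on S (\<lambda>x. g x *s v)" if "continuous_on S g"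
    for S :: "'b::topological_space set" and g and v :: "complex ^ 'n"
    using bounded_linear.continuous_on[OF bounded_linear_vector_scalar_mult that] .
  have formula: "D z v = integral {0..1} (\<lambda>t. f (z + circlepath 0 s t *s v) / circlepath 0 s t)"
    if "s > 0" "\<forall>\<zeta>\<in>cball 0 s. z + \<zeta> *s v \<in> U" for s z v
    using that complex_directional_derivative_integral[where D = "\<lambda>\<zeta>. D (z + \<zeta> *s v)", OF \<open>s > 0\<close>]
      deriv scal by auto
  have contD: "continuous_on U (\<lambda>z. D z v)" for v
  proof (rule continuous_at_imp_continuous_on, rule ballI)
    fix z1 assume "z1 \<in> U"
    obtain r s where rs: "r > 0" "s > 0"
      "\<forall>z\<in>ball z1 r. z \<in> U \<and> (\<forall>\<zeta>\<in>cball 0 s. z + \<zeta> *s v \<in> U)"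
      using local[OF \<open>z1 \<in> U\<close>] by blast
    have "continuous_on (ball z1 r)
        (\<lambda>z. integral (cbox 0 1) (\<lambda>t. f (z + circlepath 0 s t *s v) / circlepath 0 s t))"
    proof (rule integral_continuous_on_param)
      show "continuous_on (ball z1 r \<times> cbox 0 1)
          (\<lambda>(z, t). f (z + circlepath 0 s t *s v) / circlepath 0 s t)"
        unfolding split_def using rs circ[OF \<open>s > 0\<close>]
        by (intro continuous_intros continuous_on_compose2[OF contf]) auto
    qed
    then have "continuous_on (ball z1 r) (\<lambda>z. D z v)"
      using formula[OF \<open>s > 0\<close>] rs by (subst continuous_on_cong) auto
    then show "isCont (\<lambda>z. D z v) z1"
      using \<open>r > 0\<close> by (simp add: continuous_on_eq_continuous_at)
  qed
  have blD: "bounded_linear (D z)" if "z \<in> U" for z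
    using deriv[OF that] has_derivative_bounded_linear by blast
  \<comment> \<open>The Leibniz rule asks for continuity of the derivative as an operator; in finite
    dimension this follows from continuity in each direction.\<close>
  define DB where "DB z = Blinfun (D z)" for z
  have DB: "blinfun_apply (DB z) = D z" if "z \<in> U" for z
    unfolding DB_def using blD[OF that] bounded_linear_Blinfun_apply by blast
  have contDB: "continuous_on U DB"
  proof (rule continuous_on_blinfun_componentwise)
    fix i show "continuous_on U (\<lambda>z. blinfun_apply (DB z) i)"
      using contD[of i] by (subst continuous_on_cong) (auto simp: DB)
  qed
  obtain r s where rs: "r > 0" "s > 0"
    "\<forall>z\<in>ball z0 r. z \<in> U \<and> (\<forall>\<zeta>\<in>cball 0 s. z + \<zeta> *s v \<in> U)"
    using local[OF \<open>z0 \<in> U\<close>] by blast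
  \<comment> \<open>The derivative in \<open>z\<close> of the integrand in Cauchy's formula, as a
    bounded operator.\<close>
  define fx where "fx z t = blinfun_mult_right (1 / circlepath 0 s t) o\<^sub>L DB (z + circlepath 0 s t *s v)"
    for z t
  have contfx: "continuous_on (ball z0 r \<times> cbox 0 1) (\<lambda>(z, t). fx z t)"
    unfolding split_def fx_def using rs circ[OF \<open>s > 0\<close>]
    by (intro continuous_intros continuous_on_compose2[OF contDB]
        bounded_linear.continuous_on[OF bounded_linear_blinfun_mult_right]) auto
  let ?F = "\<lambda>z. integral (cbox 0 1) (\<lambda>t. f (z + circlepath 0 s t *s v) / circlepath 0 s t)"
  have "(?F has_derivative blinfun_apply (integral (cbox 0 1) (fx z0))) (at z0 within ball z0 r)"
  proof (rule leibniz_rule[OF _ _ contfx])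
    fix z and t :: real assume z: "z \<in> ball z0 r"
    have mem: "z + circlepath 0 s t *s v \<in> U"
      using rs z circ[OF \<open>s > 0\<close>] by blast
    have "((\<lambda>z. z + circlepath 0 s t *s v) has_derivative (\<lambda>w. w)) (at z within ball z0 r)"
      by (auto intro!: derivative_eq_intros)
    then have "((\<lambda>z. f (z + circlepath 0 s t *s v)) has_derivative
        D (z + circlepath 0 s t *s v)) (at z within ball z0 r)"
      using has_derivative_compose[where g = f and f = "\<lambda>z. z + circlepath 0 s t *s v"] deriv[OF mem]
      by blast
    then have "((\<lambda>z. 1 / circlepath 0 s t * f (z + circlepath 0 s t *s v)) has_derivative
        (\<lambda>w. 1 / circlepath 0 s t * D (z + circlepath 0 s t *s v) w)) (at z within ball z0 r)"
      by (rule has_derivative_mult_right)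
    then show "((\<lambda>z. f (z + circlepath 0 s t *s v) / circlepath 0 s t) has_derivative
        blinfun_apply (fx z t)) (at z within ball z0 r)"
      by (simp add: fx_def blinfun_compose.rep_eq DB[OF mem] comp_def)
  next
    fix z assume z: "z \<in> ball z0 r"
    have "continuous_on (cbox 0 1) (\<lambda>t. f (z + circlepath 0 s t *s v) / circlepath 0 s t)"
      using rs z circ[OF \<open>s > 0\<close>]
      by (intro continuous_intros continuous_on_compose2[OF contf])
         (auto simp: circlepath intro!: continuous_intros)
    then show "(\<lambda>t. f (z + circlepath 0 s t *s v) / circlepath 0 s t) integrable_on cbox 0 1"
      by (rule integrable_continuous)
  qed (use rs(1) in auto)
  then have "(?F has_derivative blinfun_apply (integral (cbox 0 1) (fx z0))) (at z0)"
    using at_within_open[of z0 "ball z0 r"] rs(1) by simp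
  then have "((\<lambda>z. D z v) has_derivative blinfun_apply (integral (cbox 0 1) (fx z0))) (at z0)"
    by (rule has_derivative_transform_within_open[where s = "ball z0 r"])
       (use rs(1,3) formula[OF \<open>s > 0\<close>] in simp_all)
  \<comment> \<open>Complex homogeneity passes from the integrand to the integral. It is what allows
    the result to be differentiated again by the same argument.\<close>
  moreover have "blinfun_apply (integral (cbox 0 1) (fx z0)) (c *s w) =
      c * blinfun_apply (integral (cbox 0 1) (fx z0)) w" for c w
  proof -
    have "continuous_on (cbox 0 1) (\<lambda>t. fx z0 t)"
      using continuous_on_compose2[OF contfx, of "cbox 0 1" "\<lambda>t. (z0, t)"] rs(1)
      by (simp add: continuous_on_Pair image_subset_iff)
    then have int: "fx z0 integrable_on cbox 0 1"
      by (rule integrable_continuous)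
    have "blinfun_apply (fx z0 t) (c *s w) = c * blinfun_apply (fx z0 t) w" for t
    proof -
      have "z0 + circlepath 0 s t *s v \<in> U"
        using bspec[OF rs(3), of z0] rs(1) circ(1)[OF \<open>s > 0\<close>] by simp
      then show ?thesis
        by (simp add: fx_def DB scal)
    qed
    then show ?thesis
      unfolding blinfun_apply_integral[OF int] by simp
  qed
  ultimately show ?thesis
    by blast
qed

section \<open>Vector-valued complex differentiable maps and the complex inverse function
  theorem\<close>

lemma has_derivative_vec_lambda:
  fixes f :: "'a::real_normed_vector \<Rightarrow> 'b::euclidean_space ^ 'm::finite"
  assumes "\<And>j. ((\<lambda>x. f x $ j) has_derivative E j) (at x)"
  shows "(f has_derivative (\<lambda>w. \<chi> j. E j w)) (at x)"
proof (subst has_derivative_componentwise_within, rule ballI)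
  fix b :: "'b ^ 'm" assume "b \<in> Basis"
  then obtain j u where b: "b = axis j u"
    by (auto simp: Basis_vec_def)
  have "((\<lambda>x. f x $ j \<bullet> u) has_derivative (\<lambda>w. E j w \<bullet> u)) (at x)"
    by (rule bounded_linear.has_derivative[OF bounded_linear_inner_left assms])
  then show "((\<lambda>x. f x \<bullet> b) has_derivative (\<lambda>w. (\<chi> j. E j w) \<bullet> b)) (at x)"
    by (simp add: b inner_axis)
qed

definition complex_linear :: "(complex ^ 'n::finite \<Rightarrow> complex ^ 'm::finite) \<Rightarrow> bool" where
  "complex_linear D \<longleftrightarrow> linear D \<and> (\<forall>c v. D (c *s v) = c *s D v)"

lemma complex_linear_bounded_linear: "complex_linear D \<Longrightarrow> bounded_linear D"
  by (simp add: complex_linear_def linear_conv_bounded_linear)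

lemma complex_linear_vec_linear: "complex_linear D \<Longrightarrow> Vector_Spaces.linear (*s) (*s) D"
  unfolding complex_linear_def by unfold_locales (auto simp: linear_add)

lemma complex_linear_add: "complex_linear D \<Longrightarrow> D (x + y) = D x + D y"
  and complex_linear_diff: "complex_linear D \<Longrightarrow> D (x - y) = D x - D y"
  and complex_linear_scale: "complex_linear D \<Longrightarrow> D (c *s x) = c *s D x"
  and complex_linear_0: "complex_linear D \<Longrightarrow> D 0 = 0"
  by (auto simp: complex_linear_def linear_add linear_diff linear_0)

lemma complex_linear_compose: "complex_linear f \<Longrightarrow> complex_linear g \<Longrightarrow> complex_linear (\<lambda>x. g (f x))"
  unfolding complex_linear_def using linear_compose[of f g] by (auto simp: comp_def)

lemma complex_linear_compose_add:
  "complex_linear f \<Longrightarrow> complex_linear g \<Longrightarrow> complex_linear (\<lambda>x. f x + g x)"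
  unfolding complex_linear_def using linear_compose_add[of f g] by (auto simp: vec.scale_right_distrib)

lemma complex_linear_compose_diff:
  "complex_linear f \<Longrightarrow> complex_linear g \<Longrightarrow> complex_linear (\<lambda>x. f x - g x)"
  unfolding complex_linear_def using linear_compose_sub[of f g] by (auto simp: vec.scale_right_diff_distrib)

lemma complex_linear_ident: "complex_linear (\<lambda>x. x)"
  by (simp add: complex_linear_def linear_iff)

lemma scaleR_eq_vector_scalar_mult: "r *\<^sub>R (z :: complex ^ 'n::finite) = complex_of_real r *s z"
  by (simp add: vec_eq_iff scaleR_conv_of_real[where 'a = complex])

lemma complex_subspace_imp_subspace: "vec.subspace S \<Longrightarrow> subspace (S :: (complex ^ 'n::finite) set)"
  by (auto simp: vec.subspace_def subspace_def scaleR_eq_vector_scalar_mult)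

definition has_complex_derivative ::
    "(complex ^ 'n::finite \<Rightarrow> complex ^ 'm::finite) \<Rightarrow> (complex ^ 'n \<Rightarrow> complex ^ 'm) \<Rightarrow>
     complex ^ 'n \<Rightarrow> bool" where
  "has_complex_derivative f D z \<longleftrightarrow> (f has_derivative D) (at z) \<and> complex_linear D"

lemma complex_differentiable_on_iff:
  "complex_differentiable_on U f \<longleftrightarrow> (\<forall>z\<in>U. \<exists>D. has_complex_derivative f D z)"
  unfolding complex_differentiable_on_def has_complex_derivative_def complex_linear_def
  using has_derivative_linear by blast

lemma has_complex_derivative_frechet:
  assumes "complex_differentiable_on U f" "z \<in> U"
  shows "has_complex_derivative f (frechet_derivative f (at z)) z"
  using assms frechet_derivative_at unfolding complex_differentiable_on_iff has_complex_derivative_def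
  by metis

lemma has_complex_derivative_compose:
  assumes "has_complex_derivative f D z" "has_complex_derivative g E (f z)"
  shows "has_complex_derivative (\<lambda>x. g (f x)) (\<lambda>x. E (D x)) z"
  using assms has_derivative_compose[of f D z UNIV g E] complex_linear_compose[of D E]
  by (simp add: has_complex_derivative_def)

lemma has_complex_derivative_add:
  assumes "has_complex_derivative f D z" "has_complex_derivative g E z"
  shows "has_complex_derivative (\<lambda>x. f x + g x) (\<lambda>x. D x + E x) z"
  using assms by (auto simp: has_complex_derivative_def intro: has_derivative_add complex_linear_compose_add)

lemma has_complex_derivative_diff_const:
  assumes "has_complex_derivative f D z"
  shows "has_complex_derivative (\<lambda>x. f x - c) D z"
  using assms has_derivative_diff[OF _ has_derivative_const, of f D "at z" c]
  by (simp add: has_complex_derivative_def)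

lemma has_complex_derivative_linear:
  "complex_linear D \<Longrightarrow> has_complex_derivative D D z"
  by (simp add: has_complex_derivative_def bounded_linear_imp_has_derivative complex_linear_bounded_linear)

lemma has_complex_derivative_ident: "has_complex_derivative (\<lambda>x. x) (\<lambda>x. x) z"
  by (rule has_complex_derivative_linear[OF complex_linear_ident])

text \<open>The Cauchy integral argument applies to each component. Closure under directional
  derivatives is the induction step of \<open>Ck_on\<close>, so a single complex derivative yields
  all orders.\<close>

lemma complex_differentiable_on_frechet_derivative:
  fixes f :: "complex ^ 'n::finite \<Rightarrow> complex ^ 'm::finite"
  assumes "open U" and f: "complex_differentiable_on U f"
  shows "complex_differentiable_on U (\<lambda>z. frechet_derivative f (at z) v)"
  unfolding complex_differentiable_on_def
proof
  fix z0 assume "z0 \<in> U"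
  define D where "D z = frechet_derivative f (at z)" for z
  have D: "(f has_derivative D z) (at z)" "D z (c *s w) = c *s D z w" if "z \<in> U" for z c w
    using has_complex_derivative_frechet[OF f that]
    by (auto simp: D_def has_complex_derivative_def complex_linear_def)
  have "\<exists>E. ((\<lambda>z. D z v $ j) has_derivative E) (at z0) \<and> (\<forall>c w. E (c *s w) = c * E w)" for j
  proof (rule complex_derivative_has_derivative[OF \<open>open U\<close> _ _ \<open>z0 \<in> U\<close>])
    show "((\<lambda>z. f z $ j) has_derivative (\<lambda>w. D z w $ j)) (at z)" if "z \<in> U" for z
      using bounded_linear.has_derivative[OF bounded_linear_vec_nth D(1)[OF that]] .
  qed (use D in auto)
  then obtain E where E: "\<And>j. ((\<lambda>z. D z v $ j) has_derivative E j) (at z0)"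
      "\<And>j c w. E j (c *s w) = c * E j w"
    by metis
  have "((\<lambda>z. D z v) has_derivative (\<lambda>w. \<chi> j. E j w)) (at z0)"
    by (rule has_derivative_vec_lambda) (simp add: E(1))
  then show "\<exists>E. ((\<lambda>z. frechet_derivative f (at z) v) has_derivative E) (at z0) \<and>
      (\<forall>c v. E (c *s v) = c *s E v)"
    unfolding D_def by (intro exI[of _ "\<lambda>w. \<chi> j. E j w"]) (auto simp: E(2) vec_eq_iff)
qed

lemma complex_differentiable_on_imp_continuous_on:
  "complex_differentiable_on U f \<Longrightarrow> continuous_on U f"
  unfolding complex_differentiable_on_def
  by (meson continuous_at_imp_continuous_on has_derivative_continuous)

lemma complex_differentiable_on_imp_Ck_on:
  assumes "open U" "complex_differentiable_on U f"
  shows "Ck_on k U f"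
  using assms(2)
proof (induction k arbitrary: f)
  case 0
  then show ?case
    by (simp add: complex_differentiable_on_imp_continuous_on)
next
  case (Suc k)
  have "f differentiable (at z)" if "z \<in> U" for z
    using Suc.prems that unfolding complex_differentiable_on_def differentiable_def by blast
  then show ?case
    using Suc.IH complex_differentiable_on_frechet_derivative[OF \<open>open U\<close> Suc.prems] by simp
qed

lemma complex_differentiable_on_imp_smooth_on:
  "open U \<Longrightarrow> complex_differentiable_on U f \<Longrightarrow> smooth_on U f"
  by (simp add: smooth_on_def complex_differentiable_on_imp_Ck_on)

text \<open>This is the form in which the inverse function theorem takes the derivative: a
  continuous map into bounded operators.\<close>

lemma complex_differentiable_on_blinfun:
  fixes f :: "complex ^ 'n::finite \<Rightarrow> complex ^ 'm::finite"
  assumes "open U" and f: "complex_differentiable_on U f"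
  obtains f' where "continuous_on U f'"
    "\<And>z. z \<in> U \<Longrightarrow> has_complex_derivative f (blinfun_apply (f' z)) z"
proof -
  define f' where "f' z = Blinfun (frechet_derivative f (at z))" for z
  have app: "blinfun_apply (f' z) = frechet_derivative f (at z)" if "z \<in> U" for z
    using has_complex_derivative_frechet[OF f that]
    by (simp add: f'_def bounded_linear_Blinfun_apply has_complex_derivative_def
        complex_linear_bounded_linear)
  have "continuous_on U f'"
  proof (rule continuous_on_blinfun_componentwise)
    fix v
    have "continuous_on U (\<lambda>z. frechet_derivative f (at z) v)"
      using complex_differentiable_on_imp_continuous_on
        complex_differentiable_on_frechet_derivative[OF assms] by blast
    then show "continuous_on U (\<lambda>z. blinfun_apply (f' z) v)"
      by (subst continuous_on_cong[OF refl, where g = "\<lambda>z. frechet_derivative f (at z) v"])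
         (auto simp: app)
  qed
  then show thesis
    using that app has_complex_derivative_frechet[OF f] by metis
qed

text \<open>The real inverse function theorem supplies \<open>g\<close>. Its derivative is the
  inverse of a complex linear bijection, hence complex linear, and so \<open>g\<close> is again
  complex differentiable. With the identity as derivative at \<open>x0\<close>, the derivative of
  \<open>g\<close> at \<open>f x0\<close> is the identity too.\<close>

lemma complex_inverse_function:
  fixes f :: "complex ^ 'n::finite \<Rightarrow> complex ^ 'n"
  assumes "open U" "complex_differentiable_on U f" "x0 \<in> U"
    and id: "(f has_derivative (\<lambda>x. x)) (at x0)"
  obtains U' V g where "open U'" "U' \<subseteq> U" "x0 \<in> U'" "open V" "f x0 \<in> V" "homeomorphism U' V f g"
    "complex_differentiable_on V g" "has_complex_derivative g (\<lambda>x. x) (f x0)"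
proof -
  obtain f' where contf': "continuous_on U f'"
    and f': "\<And>z. z \<in> U \<Longrightarrow> has_complex_derivative f (blinfun_apply (f' z)) z"
    using complex_differentiable_on_blinfun[OF assms(1,2)] by blast
  have f'x0: "blinfun_apply (f' x0) = (\<lambda>x. x)"
    using f'[OF \<open>x0 \<in> U\<close>] has_derivative_unique[OF id] unfolding has_complex_derivative_def by metis
  \<comment> \<open>The identity serves as the left inverse of the derivative at \<open>x0\<close>
    that the theorem takes as an argument.\<close>
  have inv: "id_blinfun o\<^sub>L f' x0 = id_blinfun"
    by (rule blinfun_eqI) (simp add: f'x0)
  obtain U' V g g' where g: "open U'" "U' \<subseteq> U" "x0 \<in> U'" "open V" "f x0 \<in> V" "homeomorphism U' V f g"
    "\<And>y. y \<in> V \<Longrightarrow> (g has_derivative (g' y)) (at y)"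
    "\<And>y. y \<in> V \<Longrightarrow> g' y = Hilbert_Choice.inv (blinfun_apply (f' (g y)))"
    "\<And>y. y \<in> V \<Longrightarrow> bij (blinfun_apply (f' (g y)))"
    using inverse_function_theorem[OF \<open>open U\<close> _ contf' \<open>x0 \<in> U\<close> inv] f'
    unfolding has_complex_derivative_def by (metis (no_types, lifting))
  have hg: "has_complex_derivative g (g' y) y" if "y \<in> V" for y
  proof -
    have "g y \<in> U"
      using g(2,6) that by (auto simp: homeomorphism_def)
    then have lin: "complex_linear (blinfun_apply (f' (g y)))"
      using f' by (simp add: has_complex_derivative_def)
    have "g' y (c *s v) = c *s g' y v" for c v
    proof -
      have "blinfun_apply (f' (g y)) (c *s g' y v) = c *s v"
        using g(8,9)[OF that] by (simp add: complex_linear_scale[OF lin] bij_is_surj surj_f_inv_f)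
      then show ?thesis
        using g(8,9)[OF that] by (metis bij_inv_eq_iff)
    qed
    then show ?thesis
      using g(7)[OF that] has_derivative_linear
      by (auto simp: has_complex_derivative_def complex_linear_def)
  qed
  have "g (f x0) = x0"
    using g(3,6) by (auto simp: homeomorphism_def)
  then have "g' (f x0) = (\<lambda>x. x)"
    using g(8)[OF g(5)] f'x0 by (simp add: inv_equality)
  then have "has_complex_derivative g (\<lambda>x. x) (f x0)"
    using hg[OF g(5)] by simp
  moreover have "complex_differentiable_on V g"
    using hg complex_differentiable_on_iff by blast
  ultimately show thesis
    using that[OF g(1-6)] by blast
qed

section \<open>Submanifolds and tangent spaces\<close>

lemma subspace_projection:
  fixes T :: "'a::euclidean_space set"
  assumes "subspace T"
  obtains \<pi> where "linear \<pi>" "\<And>v. \<pi> v \<in> T" "\<And>v. v \<in> T \<Longrightarrow> \<pi> v = v"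
  using linear_exists_left_inverse_on[OF linear_id assms] by auto

lemma open_contains_symmetric_interval:
  assumes "open S" "(0::real) \<in> S"
  obtains \<epsilon> where "\<epsilon> > 0" "{-\<epsilon><..<\<epsilon>} \<subseteq> S"
  using openE[OF assms] by (auto simp: ball_eq_greaterThanLessThan)

lemma has_vector_derivative_affine:
  "((\<lambda>t. x + t *\<^sub>R w) has_vector_derivative w) (at t)"
  by (auto intro!: derivative_eq_intros)

text \<open>The witnessing curve is the image under \<open>h\<close> of the straight line through
  \<open>y\<close> in direction \<open>w\<close>. It is applied to inverse charts and to graph maps,
  both of which send pieces of linear subspaces into the manifold.\<close>

lemma tangent_spaceI_affine:
  fixes h :: "'a::euclidean_space \<Rightarrow> 'b::euclidean_space"
  assumes "open V" "smooth_on V h" "y \<in> V" "(h has_derivative D) (at y)"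
    and in_M: "\<And>t. y + t *\<^sub>R w \<in> V \<Longrightarrow> h (y + t *\<^sub>R w) \<in> M"
  shows "D w \<in> tangent_space M (h y)"
proof -
  let ?S = "{t. y + t *\<^sub>R w \<in> V}"
  have smooth: "smooth_on ?S (\<lambda>t. h (y + t *\<^sub>R w))"
    using smooth_on_compose_affine[OF bounded_linear_scaleR_left assms(1,2)] by simp
  have "open ?S"
    using open_vimage[OF \<open>open V\<close>, of "\<lambda>t. y + t *\<^sub>R w"] by (simp add: vimage_def continuous_intros)
  then obtain \<epsilon> where \<epsilon>: "\<epsilon> > 0" "{-\<epsilon><..<\<epsilon>} \<subseteq> ?S"
    using open_contains_symmetric_interval[of ?S] \<open>y \<in> V\<close> by auto
  have "(h has_derivative D) (at (y + 0 *\<^sub>R w))"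
    using assms(4) by simp
  then have "((\<lambda>t. h (y + t *\<^sub>R w)) has_derivative (\<lambda>t. D (t *\<^sub>R w))) (at 0)"
    using has_derivative_compose[OF has_vector_derivative_affine[unfolded has_vector_derivative_def]]
    by blast
  moreover have "linear D"
    using assms(4) has_derivative_linear by blast
  ultimately have "((\<lambda>t. h (y + t *\<^sub>R w)) has_vector_derivative D w) (at 0)"
    by (simp add: has_vector_derivative_def linear_scale)
  then show ?thesis
    unfolding tangent_space_def using \<epsilon> smooth_on_subset[OF smooth \<epsilon>(2)] in_M
    by (intro CollectI exI[of _ "\<lambda>t. h (y + t *\<^sub>R w)"] exI[of _ \<epsilon>]) auto
qed

text \<open>Let \<open>\<pi>\<close> project onto \<open>L\<close>. Along a curve in
  \<open>M\<close> the difference of \<open>\<phi>\<close> and \<open>\<pi>\<close> after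
  \<open>\<phi>\<close> vanishes near time 0; differentiating gives
  \<open>A v = \<pi> (A v)\<close>.\<close>

lemma tangent_space_slice:
  fixes \<phi> :: "'a::euclidean_space \<Rightarrow> 'b::euclidean_space"
  assumes "open U" "p \<in> U" "(\<phi> has_derivative A) (at p)" "subspace L" "\<phi> ` (M \<inter> U) \<subseteq> L"
    and "v \<in> tangent_space M p"
  shows "A v \<in> L"
proof -
  obtain \<gamma> \<epsilon> where \<gamma>: "\<epsilon> > 0" "smooth_on {-\<epsilon><..<\<epsilon>} \<gamma>" "\<gamma> ` {-\<epsilon><..<\<epsilon>} \<subseteq> M" "\<gamma> 0 = p"
    "(\<gamma> has_vector_derivative v) (at 0)"
    using assms(6) by (auto simp: tangent_space_def)
  obtain \<pi> where \<pi>: "linear \<pi>" "\<And>v. \<pi> v \<in> L" "\<And>v. v \<in> L \<Longrightarrow> \<pi> v = v"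
    using subspace_projection[OF \<open>subspace L\<close>] by blast
  have "(\<phi> has_derivative A) (at (\<gamma> 0))"
    using \<gamma>(4) assms(3) by simp
  then have "((\<lambda>t. \<phi> (\<gamma> t)) has_derivative (\<lambda>t. A (t *\<^sub>R v))) (at 0)"
    using has_derivative_compose[OF \<gamma>(5)[unfolded has_vector_derivative_def]] by blast
  moreover have "bounded_linear (\<lambda>x. x - \<pi> x)"
    using \<pi>(1) by (simp add: bounded_linear_sub linear_conv_bounded_linear)
  ultimately have deriv: "((\<lambda>t. \<phi> (\<gamma> t) - \<pi> (\<phi> (\<gamma> t))) has_derivative
      (\<lambda>t. A (t *\<^sub>R v) - \<pi> (A (t *\<^sub>R v)))) (at 0)"
    using bounded_linear.has_derivative[of "\<lambda>x. x - \<pi> x"] by blast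
  have "continuous_on {-\<epsilon><..<\<epsilon>} \<gamma>"
    using \<gamma>(2) Ck_on.simps(1) unfolding smooth_on_def by blast
  then have "open ({-\<epsilon><..<\<epsilon>} \<inter> \<gamma> -` U)"
    by (simp add: \<open>open U\<close> continuous_on_open_vimage open_greaterThanLessThan Int_commute)
  moreover have "0 \<in> {-\<epsilon><..<\<epsilon>} \<inter> \<gamma> -` U"
    using \<gamma>(1,4) \<open>p \<in> U\<close> by auto
  moreover have "\<phi> (\<gamma> t) - \<pi> (\<phi> (\<gamma> t)) = 0" if "t \<in> {-\<epsilon><..<\<epsilon>} \<inter> \<gamma> -` U" for t
  proof -
    have "\<phi> (\<gamma> t) \<in> L"
      using that \<gamma>(3) assms(5) by blast
    then show ?thesis
      by (simp add: \<pi>(3))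
  qed
  ultimately have "((\<lambda>t. 0) has_derivative (\<lambda>t. A (t *\<^sub>R v) - \<pi> (A (t *\<^sub>R v)))) (at 0)"
    by (rule has_derivative_transform_within_open[OF deriv])
  then have "(\<lambda>t. A (t *\<^sub>R v) - \<pi> (A (t *\<^sub>R v))) = (\<lambda>t. 0)"
    using has_derivative_unique has_derivative_const by blast
  then have "A (1 *\<^sub>R v) - \<pi> (A (1 *\<^sub>R v)) = 0"
    by meson
  then have "A v = \<pi> (A v)"
    by simp
  then show ?thesis
    using \<pi>(2) by metis
qed

lemma has_derivative_left_inverse:
  assumes "open U" "p \<in> U" "(\<phi> has_derivative A) (at p)" "(\<psi> has_derivative C) (at (\<phi> p))"
    and "\<And>x. x \<in> U \<Longrightarrow> \<psi> (\<phi> x) = x"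
  shows "C (A v) = v"
proof -
  have "((\<lambda>x. \<psi> (\<phi> x)) has_derivative (\<lambda>v. C (A v))) (at p)"
    using has_derivative_compose assms(3,4) by blast
  then have "((\<lambda>x. x) has_derivative (\<lambda>v. C (A v))) (at p)"
    by (rule has_derivative_transform_within_open[OF _ assms(1,2)]) (simp add: assms(5))
  then show ?thesis
    using has_derivative_unique[OF _ has_derivative_ident] by metis
qed

text \<open>Curves are pushed forward by \<open>B\<close>. Conjugation as \<open>B\<close> gives
  invariance of tangent spaces, \<open>complex_vec\<close> the easy inclusion for real points, and
  the identity monotonicity in the set.\<close>

lemma tangent_space_bounded_linear_image:
  assumes "bounded_linear B" "\<And>x. x \<in> M \<Longrightarrow> B x \<in> M'" "v \<in> tangent_space M p"
  shows "B v \<in> tangent_space M' (B p)"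
proof -
  obtain \<gamma> \<epsilon> where \<gamma>: "\<epsilon> > 0" "smooth_on {-\<epsilon><..<\<epsilon>} \<gamma>" "\<gamma> ` {-\<epsilon><..<\<epsilon>} \<subseteq> M" "\<gamma> 0 = p"
    "(\<gamma> has_vector_derivative v) (at 0)"
    using assms(3) by (auto simp: tangent_space_def)
  have "smooth_on {-\<epsilon><..<\<epsilon>} (\<lambda>t. B (\<gamma> t))"
    using smooth_on_bounded_linear[OF assms(1) _ \<gamma>(2)] by simp
  moreover have "((\<lambda>t. B (\<gamma> t)) has_vector_derivative B v) (at 0)"
    using bounded_linear.has_vector_derivative[OF assms(1) \<gamma>(5)] .
  moreover have "(\<lambda>t. B (\<gamma> t)) ` {-\<epsilon><..<\<epsilon>} \<subseteq> M'"
    using \<gamma>(3) assms(2) by blast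
  ultimately show ?thesis
    unfolding tangent_space_def using \<gamma>(1,4) by blast
qed

text \<open>Near \<open>x0\<close> the set \<open>M\<close> is the graph of \<open>s\<close> over
  \<open>range \<pi>\<close>, and subtracting the graph straightens it. The map \<open>s\<close> is
  compared with \<open>M\<close> only at fixed points of \<open>\<pi>\<close>, which by idempotence
  are the points of \<open>range \<pi>\<close>.\<close>

lemma smooth_submanifold_graph:
  fixes M :: "'a::euclidean_space set"
  assumes "open U" "x0 \<in> U" "open W" "0 \<in> W" "smooth_on W s" "linear \<pi>" "\<And>v. \<pi> (\<pi> v) = \<pi> v"
    and sM: "\<And>y. y \<in> W \<Longrightarrow> \<pi> y = y \<Longrightarrow> s y \<in> M"
    and s\<pi>: "\<And>y. y \<in> W \<Longrightarrow> \<pi> y = y \<Longrightarrow> \<pi> (s y - x0) = y"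
    and M\<pi>: "\<And>x. x \<in> M \<Longrightarrow> x \<in> U \<Longrightarrow> \<pi> (x - x0) \<in> W"
    and Ms: "\<And>x. x \<in> M \<Longrightarrow> x \<in> U \<Longrightarrow> s (\<pi> (x - x0)) = x"
  shows "\<exists>U (V :: 'a set) \<phi> \<psi>. open U \<and> x0 \<in> U \<and> open V \<and> homeomorphism U V \<phi> \<psi> \<and>
           smooth_on U \<phi> \<and> smooth_on V \<psi> \<and> \<phi> ` (M \<inter> U) = range \<pi> \<inter> V"
proof -
  have bl: "bounded_linear \<pi>"
    using \<open>linear \<pi>\<close> by (simp add: linear_conv_bounded_linear)
  define c where "c = - \<pi> x0"
  have c: "c + \<pi> x = \<pi> (x - x0)" for x
    by (simp add: c_def linear_diff[OF \<open>linear \<pi>\<close>])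
  \<comment> \<open>\<open>\<Psi> x\<close> is the base coordinate \<open>c + \<pi> x\<close> plus
    the displacement \<open>x - s (c + \<pi> x)\<close> from the graph. For
    \<open>c + \<pi> x\<close> in \<open>W\<close> the displacement lies in the kernel of
    \<open>\<pi>\<close>, and it is zero on \<open>M\<close> inside \<open>U\<close>.
    \<open>\<Theta>\<close> reassembles the two parts. Both are written as an affine map plus or
    minus \<open>s\<close> after an affine map, to match the smoothness lemmas.\<close>
  define \<Psi> where "\<Psi> x = (c + (x + \<pi> x)) + - s (c + \<pi> x)" for x
  define \<Theta> where "\<Theta> y = (0 + (y - \<pi> y)) + s (0 + \<pi> y)" for y
  define U1 where "U1 = {x. c + \<pi> x \<in> W}"
  define V1 where "V1 = {y. 0 + \<pi> y \<in> W}"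
  have open1: "open U1" "open V1"
    unfolding U1_def V1_def using open_vimage[OF \<open>open W\<close>, of "\<lambda>x. c' + \<pi> x" for c']
      linear_continuous_on[OF bl, of UNIV]
    by (simp_all add: vimage_def continuous_on_add del: add_0)
  have neg: "smooth_on W (\<lambda>y. - s y)"
    using smooth_on_bounded_linear[OF bounded_linear_minus[OF bounded_linear_ident] assms(3,5)] .
  have smooth1: "smooth_on U1 \<Psi>"
    unfolding \<Psi>_def U1_def
    by (rule smooth_on_add[OF open1(1)[unfolded U1_def] smooth_on_affine smooth_on_compose_affine])
       (intro bounded_linear_intros bl assms neg)+
  have smooth2: "smooth_on V1 \<Theta>"
    unfolding \<Theta>_def V1_def
    by (rule smooth_on_add[OF open1(2)[unfolded V1_def] smooth_on_affine smooth_on_compose_affine])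
       (intro bounded_linear_intros bl assms)+
  have \<pi>: "\<pi> (c + \<pi> x) = c + \<pi> x" for x
    unfolding c using assms(7) .
  have \<Psi>: "\<pi> (\<Psi> x) = c + \<pi> x" "\<Theta> (\<Psi> x) = x" if "x \<in> U1" for x
  proof -
    have mem: "c + \<pi> x \<in> W"
      using that by (simp add: U1_def)
    have "\<pi> (s (c + \<pi> x)) - \<pi> x0 = c + \<pi> x"
      using s\<pi>[OF mem \<pi>] by (simp add: linear_diff[OF \<open>linear \<pi>\<close>])
    moreover have "\<pi> (\<Psi> x) = \<pi> (c + \<pi> x) + \<pi> x - \<pi> (s (c + \<pi> x))"
      unfolding \<Psi>_def using \<open>linear \<pi>\<close> by (simp add: linear_add linear_diff linear_neg)
    ultimately show "\<pi> (\<Psi> x) = c + \<pi> x"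
      unfolding \<pi> by (simp add: c_def algebra_simps)
    then show "\<Theta> (\<Psi> x) = x"
      by (simp add: \<Theta>_def) (simp add: \<Psi>_def)
  qed
  have \<Theta>: "c + \<pi> (\<Theta> y) = \<pi> y" "\<Psi> (\<Theta> y) = y" if "y \<in> V1" for y
  proof -
    have mem: "\<pi> y \<in> W"
      using that by (simp add: V1_def)
    have "\<pi> (\<Theta> y) = \<pi> (s (\<pi> y))"
      unfolding \<Theta>_def using \<open>linear \<pi>\<close> assms(7) by (simp add: linear_add linear_diff)
    then show "c + \<pi> (\<Theta> y) = \<pi> y"
      using s\<pi>[OF mem assms(7)] by (simp add: c_def linear_diff[OF \<open>linear \<pi>\<close>])
    then show "\<Psi> (\<Theta> y) = y"
      by (simp add: \<Psi>_def add.assoc add.left_commute[of c]) (simp add: \<Theta>_def)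
  qed
  define U2 where "U2 = U1 \<inter> U"
  \<comment> \<open>The hypotheses describe \<open>M\<close> by \<open>s\<close> only inside
    \<open>U\<close>, so the range of the chart is cut down to the points that
    \<open>\<Theta>\<close> sends into \<open>U\<close>.\<close>
  define V2 where "V2 = V1 \<inter> \<Theta> -` U"
  have cont: "continuous_on U1 \<Psi>" "continuous_on V1 \<Theta>"
    using smooth1 smooth2 Ck_on.simps(1) unfolding smooth_on_def by blast+
  have "open U2" "open V2"
    using open1 \<open>open U\<close> cont continuous_on_open_vimage[OF open1(2)]
    by (auto simp: U2_def V2_def Int_commute)
  have hom: "homeomorphism U2 V2 \<Psi> \<Theta>"
  proof (rule homeomorphismI)
    show "continuous_on U2 \<Psi>" "continuous_on V2 \<Theta>"
      using cont continuous_on_subset unfolding U2_def V2_def by blast+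
    show "\<Psi> ` U2 \<subseteq> V2"
      using \<Psi> by (auto simp: U2_def V2_def V1_def) (auto simp: U1_def)
    show "\<Theta> ` V2 \<subseteq> U2"
      using \<Theta> by (auto simp: U2_def V2_def U1_def) (auto simp: V1_def)
  qed (use \<Psi> \<Theta> in \<open>auto simp: U2_def V2_def\<close>)
  have "\<Psi> ` (M \<inter> U2) = range \<pi> \<inter> V2"
  proof (intro equalityI subsetI)
    fix y assume "y \<in> \<Psi> ` (M \<inter> U2)"
    then obtain x where x: "x \<in> M" "x \<in> U2" "y = \<Psi> x"
      by blast
    have "s (c + \<pi> x) = x"
      unfolding c using Ms x by (simp add: U2_def)
    then have "y = c + \<pi> x"
      by (simp add: x(3) \<Psi>_def)
    then have "y \<in> range \<pi>"
      using c by auto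
    then show "y \<in> range \<pi> \<inter> V2"
      using hom x by (auto simp: homeomorphism_def)
  next
    fix y assume y: "y \<in> range \<pi> \<inter> V2"
    then have "\<pi> y = y"
      using assms(7) by auto
    then have "\<Theta> y \<in> M"
      using sM[of y] y by (auto simp: \<Theta>_def V2_def V1_def)
    then show "y \<in> \<Psi> ` (M \<inter> U2)"
      using hom y unfolding homeomorphism_def by (metis IntD2 IntI image_eqI)
  qed
  moreover have "x0 \<in> U2"
    using assms(2,4) by (simp add: U2_def U1_def c)(simp add: linear_0[OF \<open>linear \<pi>\<close>])
  moreover have "smooth_on U2 \<Psi>" "smooth_on V2 \<Theta>"
    unfolding U2_def V2_def
    by (auto intro: smooth_on_subset[OF smooth1] smooth_on_subset[OF smooth2])
  ultimately show ?thesis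
    using \<open>open U2\<close> \<open>open V2\<close> hom by blast
qed

text \<open>A curve in \<open>Z\<close> through a point of \<open>M\<close> has connected image and
  therefore never leaves the component.\<close>

lemma tangent_space_component:
  assumes "M \<in> components Z" "p \<in> M"
  shows "tangent_space M p = tangent_space Z p"
proof (intro equalityI subsetI)
  fix v assume "v \<in> tangent_space Z p"
  then obtain \<gamma> \<epsilon> where \<gamma>: "\<epsilon> > 0" "smooth_on {-\<epsilon><..<\<epsilon>} \<gamma>" "\<gamma> ` {-\<epsilon><..<\<epsilon>} \<subseteq> Z" "\<gamma> 0 = p"
    "(\<gamma> has_vector_derivative v) (at 0)"
    by (auto simp: tangent_space_def)
  have "connected (\<gamma> ` {-\<epsilon><..<\<epsilon>})"
    using connected_continuous_image[OF smooth_on_imp_continuous_on[OF \<gamma>(2)]] by simp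
  moreover have "p \<in> M \<inter> \<gamma> ` {-\<epsilon><..<\<epsilon>}"
    using \<gamma>(1,4) assms(2) by (auto intro: image_eqI[of _ _ 0])
  ultimately have "\<gamma> ` {-\<epsilon><..<\<epsilon>} \<subseteq> M"
    using components_maximal[OF assms(1) _ \<gamma>(3)] by blast
  then show "v \<in> tangent_space M p"
    unfolding tangent_space_def using \<gamma> by blast
next
  fix v assume "v \<in> tangent_space M p"
  then show "v \<in> tangent_space Z p"
    using tangent_space_bounded_linear_image[OF bounded_linear_ident, of M Z v p]
      in_components_subset[OF assms(1)] by blast
qed

text \<open>A manifold is locally connected: over a ball \<open>V'\<close> the slice is convex, so
  \<open>Z\<close> meets the corresponding \<open>U'\<close> in a connected set containing
  \<open>p\<close>, which lies in \<open>M\<close>. Hence \<open>M\<close> and \<open>Z\<close>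
  agree on \<open>U'\<close> and share the shrunken chart.\<close>

lemma smooth_submanifold_component:
  fixes Z :: "'a::euclidean_space set"
  assumes "smooth_submanifold d Z" "M \<in> components Z"
  shows "smooth_submanifold d M"
  unfolding smooth_submanifold_def
proof
  fix p assume "p \<in> M"
  then have "p \<in> Z"
    using in_components_subset[OF assms(2)] by blast
  then obtain U and V :: "'a set" and \<phi> \<psi> L where chart: "open U" "p \<in> U" "open V" "homeomorphism U V \<phi> \<psi>"
      "smooth_on U \<phi>" "smooth_on V \<psi>" "subspace L" "dim L = d" "\<phi> ` (Z \<inter> U) = L \<inter> V"
    using bspec[OF assms(1)[unfolded smooth_submanifold_def] \<open>p \<in> Z\<close>]
    by (elim exE conjE) (rule that; assumption)
  have hom: "\<And>x. x \<in> U \<Longrightarrow> \<psi> (\<phi> x) = x" "\<And>x. x \<in> U \<Longrightarrow> \<phi> x \<in> V" "\<And>y. y \<in> V \<Longrightarrow> \<phi> (\<psi> y) = y"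
    "\<And>y. y \<in> V \<Longrightarrow> \<psi> y \<in> U"
    using chart(4) by (auto simp: homeomorphism_def)
  obtain e where e: "e > 0" "ball (\<phi> p) e \<subseteq> V"
    using openE[OF chart(3) hom(2)[OF chart(2)]] by blast
  define V' where "V' = ball (\<phi> p) e"
  define U' where "U' = U \<inter> \<phi> -` V'"
  have "V' \<subseteq> V" "open V'"
    using e by (auto simp: V'_def)
  have "open U'"
    using continuous_on_open_vimage[OF chart(1), of \<phi>] smooth_on_imp_continuous_on[OF chart(5)] \<open>open V'\<close>
    by (simp add: U'_def Int_commute)
  have hom': "homeomorphism U' V' \<phi> \<psi>"
  proof (rule homeomorphism_of_subsets[OF chart(4) _ subset_refl])
    show "\<phi> ` U' = V'"
    proof (intro equalityI subsetI)
      fix y assume "y \<in> V'"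
      then have "y = \<phi> (\<psi> y)" "\<psi> y \<in> U'"
        using hom(3,4)[of y] \<open>V' \<subseteq> V\<close> by (auto simp: U'_def)
      then show "y \<in> \<phi> ` U'"
        by (rule image_eqI)
    qed (auto simp: U'_def)
  qed (auto simp: U'_def)
  have "convex (L \<inter> V')"
    unfolding V'_def by (intro convex_Int subspace_imp_convex chart convex_ball)
  then have "connected (\<psi> ` (L \<inter> V'))"
    using \<open>V' \<subseteq> V\<close> smooth_on_imp_continuous_on[OF chart(6)]
    by (intro connected_continuous_image convex_connected) (auto intro: continuous_on_subset)
  moreover have Z_eq: "\<psi> ` (L \<inter> V') = Z \<inter> U'"
  proof (intro equalityI subsetI)
    fix x assume "x \<in> \<psi> ` (L \<inter> V')"
    then obtain y where y: "y \<in> L" "y \<in> V'" "x = \<psi> y"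
      by blast
    then obtain z where "z \<in> Z" "z \<in> U" "y = \<phi> z"
      using \<open>V' \<subseteq> V\<close> chart(9) by blast
    then show "x \<in> Z \<inter> U'"
      using y hom(1) by (simp add: U'_def)
  next
    fix x assume "x \<in> Z \<inter> U'"
    then have "\<phi> x \<in> L \<inter> V'" "x = \<psi> (\<phi> x)"
      using chart(9) hom(1) by (auto simp: U'_def)
    then show "x \<in> \<psi> ` (L \<inter> V')"
      by (metis image_eqI)
  qed
  moreover have "p \<in> M \<inter> \<psi> ` (L \<inter> V')"
    unfolding Z_eq using \<open>p \<in> M\<close> \<open>p \<in> Z\<close> chart(2) e(1) by (simp add: U'_def V'_def)
  ultimately have "Z \<inter> U' \<subseteq> M"
    using components_maximal[OF assms(2)] by (metis empty_iff inf_le1)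
  then have "M \<inter> U' = Z \<inter> U'"
    using in_components_subset[OF assms(2)] by blast
  then have "\<phi> ` (M \<inter> U') = (\<lambda>y. \<phi> (\<psi> y)) ` (L \<inter> V')"
    unfolding Z_eq[symmetric] by (simp add: image_image)
  also have "\<dots> = (\<lambda>y. y) ` (L \<inter> V')"
    by (rule image_cong) (use hom(3) \<open>V' \<subseteq> V\<close> in auto)
  finally have "\<phi> ` (M \<inter> U') = L \<inter> V'"
    by simp
  moreover have "smooth_on U' \<phi>" "smooth_on V' \<psi>"
    using smooth_on_subset[OF chart(5)] smooth_on_subset[OF chart(6)] \<open>V' \<subseteq> V\<close>
    by (auto simp: U'_def)
  moreover have "p \<in> U'"
    using chart(2) e(1) by (simp add: U'_def V'_def)
  ultimately show "\<exists>U (V :: 'a set) \<phi> \<psi> L. open U \<and> p \<in> U \<and> open V \<and> homeomorphism U V \<phi> \<psi> \<and>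
      smooth_on U \<phi> \<and> smooth_on V \<psi> \<and> subspace L \<and> dim L = d \<and> \<phi> ` (M \<inter> U) = L \<inter> V"
    using \<open>open U'\<close> \<open>open V'\<close> hom' chart(7,8) by blast
qed

text \<open>The definition of a submersion provides some local extension \<open>g\<close>. It agrees
  with \<open>f\<close> along curves in \<open>M\<close>, so \<open>D\<close> and \<open>E\<close>
  agree on their velocities; the derivative of \<open>f\<close> itself may thus replace that of
  \<open>g\<close>.\<close>

lemma smooth_submersion_derivative:
  assumes f: "smooth_submersion M N f" "x \<in> M" and E: "(f has_derivative E) (at x)"
  shows "E ` tangent_space M x = tangent_space N (f x)"
proof -
  obtain U g D where g: "open U" "x \<in> U" "smooth_on U g" "\<forall>y\<in>M \<inter> U. g y = f y"
      "(g has_derivative D) (at x)" "D ` tangent_space M x = tangent_space N (f x)"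
    using f unfolding smooth_submersion_def by blast
  have "D v = E v" if v: "v \<in> tangent_space M x" for v
  proof -
    obtain \<gamma> \<epsilon> where \<gamma>: "\<epsilon> > 0" "smooth_on {-\<epsilon><..<\<epsilon>} \<gamma>" "\<gamma> ` {-\<epsilon><..<\<epsilon>} \<subseteq> M" "\<gamma> 0 = x"
      "(\<gamma> has_vector_derivative v) (at 0)"
      using v by (auto simp: tangent_space_def)
    have deriv: "((\<lambda>t. h (\<gamma> t)) has_derivative (\<lambda>t. H (t *\<^sub>R v))) (at 0)"
      if "(h has_derivative H) (at x)" for h H
      using has_derivative_compose[OF \<gamma>(5)[unfolded has_vector_derivative_def], of h H] that \<gamma>(4) by simp
    have "open ({-\<epsilon><..<\<epsilon>} \<inter> \<gamma> -` U)"
      using smooth_on_imp_continuous_on[OF \<gamma>(2)] g(1)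
      by (simp add: continuous_on_open_vimage open_greaterThanLessThan Int_commute)
    then have "((\<lambda>t. f (\<gamma> t)) has_derivative (\<lambda>t. D (t *\<^sub>R v))) (at 0)"
    proof (rule has_derivative_transform_within_open[OF deriv[OF g(5)]])
      show "0 \<in> {-\<epsilon><..<\<epsilon>} \<inter> \<gamma> -` U"
        using \<gamma>(1,4) g(2) by simp
      show "g (\<gamma> t) = f (\<gamma> t)" if "t \<in> {-\<epsilon><..<\<epsilon>} \<inter> \<gamma> -` U" for t
        using that \<gamma>(3) g(4) by blast
    qed
    then have "(\<lambda>t. D (t *\<^sub>R v)) = (\<lambda>t. E (t *\<^sub>R v))"
      using deriv[OF E] has_derivative_unique by blast
    then have "D (1 *\<^sub>R v) = E (1 *\<^sub>R v)"
      by meson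
    then show ?thesis
      by simp
  qed
  then show ?thesis
    using g(6) by (metis image_cong)
qed

section \<open>Complex submanifolds as graphs over their tangent spaces\<close>

text \<open>\<open>A\<close> and \<open>C\<close> are the derivatives of the chart and of its
  inverse. The chart carries curves in \<open>Z\<close> into \<open>L\<close>; conversely, the lines
  \<open>\<phi> p + t A v\<close> with \<open>A v\<close> in \<open>L\<close> pull back to curves in
  \<open>Z\<close>.\<close>

lemma complex_submanifold_chart:
  fixes Z :: "(complex ^ 'n::finite) set"
  assumes "complex_submanifold d Z" "p \<in> Z"
  obtains U V and \<phi> \<psi> :: "complex ^ 'n \<Rightarrow> complex ^ 'n" and L A C where "open U" "p \<in> U" "open V" "homeomorphism U V \<phi> \<psi>"
    "complex_differentiable_on U \<phi>" "vec.subspace L" "vec.dim L = d" "\<phi> ` (Z \<inter> U) = L \<inter> V"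
    "has_complex_derivative \<phi> A p" "complex_linear C" "\<And>v. C (A v) = v" "\<And>v. A (C v) = v"
    "tangent_space Z p = {v. A v \<in> L}"
proof -
  obtain U V and \<phi> \<psi> :: "complex ^ 'n \<Rightarrow> complex ^ 'n" and L where chart: "open U" "p \<in> U" "open V" "homeomorphism U V \<phi> \<psi>"
      "complex_differentiable_on U \<phi>" "complex_differentiable_on V \<psi>" "vec.subspace L"
      "vec.dim L = d" "\<phi> ` (Z \<inter> U) = L \<inter> V"
    using bspec[OF assms(1)[unfolded complex_submanifold_def] assms(2)]
    by (elim exE conjE) (rule that; assumption)
  have \<psi>: "\<psi> (\<phi> x) = x" if "x \<in> U" for x
    using chart(4) that by (simp add: homeomorphism_def)
  have \<phi>: "\<phi> (\<psi> y) = y" "\<psi> y \<in> U" if "y \<in> V" for y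
    using chart(4) that by (auto simp: homeomorphism_def)
  have "\<phi> p \<in> V"
    using chart(2,4) by (auto simp: homeomorphism_def)
  obtain A where A: "has_complex_derivative \<phi> A p"
    using chart(2,5) complex_differentiable_on_iff by blast
  obtain C where C: "has_complex_derivative \<psi> C (\<phi> p)"
    using \<open>\<phi> p \<in> V\<close> chart(6) complex_differentiable_on_iff by blast
  have CA: "C (A v) = v" for v
    using has_derivative_left_inverse[OF chart(1,2), of \<phi> A \<psi> C] A C \<psi>
    by (auto simp: has_complex_derivative_def)
  have AC: "A (C v) = v" for v
    using has_derivative_left_inverse[OF chart(3) \<open>\<phi> p \<in> V\<close>, of \<psi> C \<phi> A] A C \<phi>(1) \<psi>[OF chart(2)]
    by (auto simp: has_complex_derivative_def)
  have "tangent_space Z p = {v. A v \<in> L}"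
  proof (intro equalityI subsetI CollectI)
    fix v assume "v \<in> tangent_space Z p"
    then show "A v \<in> L"
      using tangent_space_slice[OF chart(1,2), of \<phi> A L Z v] A chart(7,9)
      by (auto simp: has_complex_derivative_def complex_subspace_imp_subspace)
  next
    fix v assume v: "v \<in> {v. A v \<in> L}"
    have "\<phi> p \<in> L"
      using chart(2,9) assms(2) by blast
    have "C (A v) \<in> tangent_space Z (\<psi> (\<phi> p))"
    proof (rule tangent_spaceI_affine[where h = \<psi> and D = C and w = "A v",
          OF chart(3) _ \<open>\<phi> p \<in> V\<close>])
      show "smooth_on V \<psi>"
        using chart(3,6) complex_differentiable_on_imp_smooth_on by blast
      show "(\<psi> has_derivative C) (at (\<phi> p))"
        using C by (simp add: has_complex_derivative_def)
      fix t assume t: "\<phi> p + t *\<^sub>R A v \<in> V"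
      have "\<phi> p + t *\<^sub>R A v \<in> L"
        using v \<open>\<phi> p \<in> L\<close> complex_subspace_imp_subspace[OF chart(7)]
        by (simp add: subspace_add subspace_scale)
      then obtain z where "z \<in> Z \<inter> U" "\<phi> p + t *\<^sub>R A v = \<phi> z"
        using t chart(9) by blast
      then show "\<psi> (\<phi> p + t *\<^sub>R A v) \<in> Z"
        using \<psi> by simp
    qed
    then show "v \<in> tangent_space Z p"
      using CA \<psi>[OF chart(2)] by simp
  qed
  then show thesis
    using that chart A CA AC C by (auto simp: has_complex_derivative_def)
qed

text \<open>\<open>C\<close> maps \<open>L\<close> isomorphically onto the tangent space, so a set
  of velocities of real curves turns out to be closed under complex scalars.\<close>

lemma complex_submanifold_tangent_space:
  fixes Z :: "(complex ^ 'n::finite) set"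
  assumes "complex_submanifold d Z" "p \<in> Z"
  shows "vec.subspace (tangent_space Z p)" "vec.dim (tangent_space Z p) = d"
proof -
  obtain U V and \<phi> \<psi> :: "complex ^ 'n \<Rightarrow> complex ^ 'n" and L A C where chart: "open U" "p \<in> U" "open V" "homeomorphism U V \<phi> \<psi>"
    "complex_differentiable_on U \<phi>" "vec.subspace L" "vec.dim L = d" "\<phi> ` (Z \<inter> U) = L \<inter> V"
    "has_complex_derivative \<phi> A p" "complex_linear C" "\<And>v. C (A v) = v" "\<And>v. A (C v) = v"
    "tangent_space Z p = {v. A v \<in> L}"
    by (rule complex_submanifold_chart[OF assms]) (rule that; assumption)
  have A: "complex_linear A"
    using chart(9) by (simp add: has_complex_derivative_def)
  show "vec.subspace (tangent_space Z p)"
    using chart(6) unfolding chart(13) vec.subspace_def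
    by (auto simp: complex_linear_0[OF A] complex_linear_add[OF A] complex_linear_scale[OF A])
  have "tangent_space Z p = C ` L"
  proof (intro equalityI subsetI)
    fix v assume "v \<in> tangent_space Z p"
    then show "v \<in> C ` L"
      by (intro image_eqI[of v C "A v"]) (simp_all add: chart(11,13))
  qed (auto simp: chart(12,13))
  moreover have "inj_on C (vec.span L)"
    using chart(12) by (metis inj_onI)
  ultimately show "vec.dim (tangent_space Z p) = d"
    using vec.dim_image_eq[OF complex_linear_vec_linear[OF chart(10)]] chart(7) by metis
qed

text \<open>The graph map is the local inverse of a map with identity derivative at
  \<open>p\<close>. The projection \<open>Pr\<close> is left to the caller, so that one compatible
  with conjugation can be supplied. \<open>\<sigma>\<close> lives on an open set of the whole space,
  but it parametrizes \<open>Z\<close> by the fixed points of \<open>Pr\<close>, that is, by tangent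
  vectors.\<close>

lemma complex_submanifold_graph:
  fixes Z :: "(complex ^ 'n::finite) set"
  assumes "complex_submanifold d Z" "p \<in> Z" and Pr: "complex_linear Pr"
    and Pr_in: "\<And>v. Pr v \<in> tangent_space Z p" and Pr_id: "\<And>v. v \<in> tangent_space Z p \<Longrightarrow> Pr v = v"
  obtains U W \<sigma> where "open U" "p \<in> U" "open W" "0 \<in> W" "complex_differentiable_on W \<sigma>"
    "has_complex_derivative \<sigma> (\<lambda>x. x) 0" "\<sigma> 0 = p"
    "\<And>y. y \<in> W \<Longrightarrow> Pr y = y \<Longrightarrow> \<sigma> y \<in> Z" "\<And>y. y \<in> W \<Longrightarrow> Pr y = y \<Longrightarrow> Pr (\<sigma> y - p) = y"
    "\<And>x. x \<in> Z \<Longrightarrow> x \<in> U \<Longrightarrow> Pr (x - p) \<in> W" "\<And>x. x \<in> Z \<Longrightarrow> x \<in> U \<Longrightarrow> \<sigma> (Pr (x - p)) = x"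
proof -
  obtain U V and \<phi> \<psi> :: "complex ^ 'n \<Rightarrow> complex ^ 'n" and L A C where chart: "open U" "p \<in> U" "open V" "homeomorphism U V \<phi> \<psi>"
    "complex_differentiable_on U \<phi>" "vec.subspace L" "vec.dim L = d" "\<phi> ` (Z \<inter> U) = L \<inter> V"
    "has_complex_derivative \<phi> A p" "complex_linear C" "\<And>v. C (A v) = v" "\<And>v. A (C v) = v"
    "tangent_space Z p = {v. A v \<in> L}"
    by (rule complex_submanifold_chart[OF assms(1,2)]) (rule that; assumption)
  \<comment> \<open>\<open>R\<close> is \<open>id - Pr\<close> after \<open>C\<close>. It kills
    \<open>L\<close> because \<open>C\<close> maps \<open>L\<close> into the tangent space. Since
    \<open>C\<close> inverts \<open>A\<close>, the maps \<open>Pr\<close> and \<open>R\<close> after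
    \<open>A\<close> add up to the identity, which is the derivative wanted at
    \<open>p\<close>.\<close>
  define R where "R y = C y - Pr (C y)" for y
  have R: "complex_linear R"
    unfolding R_def using complex_linear_compose_diff[OF chart(10) complex_linear_compose[OF chart(10) Pr]] .
  \<comment> \<open>On \<open>Z\<close> the second summand vanishes; it always lies in the kernel of \<open>Pr\<close>, so \<open>\<Phi> x\<close> fixed by
    \<open>Pr\<close> forces \<open>x\<close> into \<open>Z\<close>.\<close>
  define \<Phi> where "\<Phi> x = Pr (x - p) + R (\<phi> x - \<phi> p)" for x
  have deriv: "has_complex_derivative \<Phi> (\<lambda>w. Pr w + R (E w)) x" if "has_complex_derivative \<phi> E x" for E x
    unfolding \<Phi>_def
    by (intro has_complex_derivative_add
        has_complex_derivative_compose[OF _ has_complex_derivative_linear[OF Pr]]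
        has_complex_derivative_compose[OF _ has_complex_derivative_linear[OF R]]
        has_complex_derivative_diff_const that has_complex_derivative_ident)
  have "complex_differentiable_on U \<Phi>"
    using deriv chart(5) unfolding complex_differentiable_on_iff by blast
  moreover have "(\<Phi> has_derivative (\<lambda>x. x)) (at p)"
    using deriv[OF chart(9)] by (simp add: has_complex_derivative_def R_def chart(11))
  ultimately obtain U' W \<sigma> where \<sigma>: "open U'" "U' \<subseteq> U" "p \<in> U'" "open W" "\<Phi> p \<in> W"
    "homeomorphism U' W \<Phi> \<sigma>" "complex_differentiable_on W \<sigma>"
    "has_complex_derivative \<sigma> (\<lambda>x. x) (\<Phi> p)"
    by (rule complex_inverse_function[OF chart(1) _ chart(2)]) (rule that; assumption)
  have "\<Phi> p = 0"
    by (simp add: \<Phi>_def complex_linear_0[OF Pr] complex_linear_0[OF R])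
  have hom: "\<And>x. x \<in> U' \<Longrightarrow> \<sigma> (\<Phi> x) = x" "\<And>x. x \<in> U' \<Longrightarrow> \<Phi> x \<in> W"
    "\<And>y. y \<in> W \<Longrightarrow> \<Phi> (\<sigma> y) = y" "\<And>y. y \<in> W \<Longrightarrow> \<sigma> y \<in> U'"
    using \<sigma>(6) by (auto simp: homeomorphism_def)
  have "\<phi> p \<in> L"
    using chart(2,8) assms(2) by blast
  have \<Phi>_Z: "\<Phi> x = Pr (x - p)" if "x \<in> Z" "x \<in> U'" for x
  proof -
    have "\<phi> x \<in> L"
      using that \<sigma>(2) chart(8) by blast
    then have "\<phi> x - \<phi> p \<in> L"
      using \<open>\<phi> p \<in> L\<close> chart(6) by (simp add: vec.subspace_diff)
    then have "C (\<phi> x - \<phi> p) \<in> tangent_space Z p"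
      by (simp add: chart(12,13))
    then show ?thesis
      by (simp add: \<Phi>_def R_def Pr_id)
  qed
  have proj: "Pr (\<sigma> y - p) = y" "\<sigma> y \<in> Z" if "y \<in> W" "Pr y = y" for y
  proof -
    let ?x = "\<sigma> y"
    have y: "Pr (?x - p) + R (\<phi> ?x - \<phi> p) = y"
      using hom(3)[OF that(1)] by (simp add: \<Phi>_def)
    have "Pr (R z) = 0" for z
      by (simp add: R_def complex_linear_diff[OF Pr] Pr_id Pr_in)
    moreover have "Pr y = Pr (Pr (?x - p) + R (\<phi> ?x - \<phi> p))"
      using y by simp
    ultimately have "Pr y = Pr (?x - p)"
      by (simp add: complex_linear_add[OF Pr] Pr_id Pr_in)
    then show *: "Pr (?x - p) = y"
      using that(2) by simp
    then have "C (\<phi> ?x - \<phi> p) = Pr (C (\<phi> ?x - \<phi> p))"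
      using y by (simp add: R_def)
    then have "C (\<phi> ?x - \<phi> p) \<in> tangent_space Z p"
      using Pr_in by metis
    then have "\<phi> ?x - \<phi> p \<in> L"
      by (simp add: chart(12,13))
    then have "\<phi> ?x - \<phi> p + \<phi> p \<in> L"
      using \<open>\<phi> p \<in> L\<close> chart(6) vec.subspace_add by blast
    moreover have U: "?x \<in> U"
      using hom(4) that(1) \<sigma>(2) by blast
    ultimately have "\<phi> ?x \<in> L \<inter> V"
      using chart(4) by (auto simp: homeomorphism_def)
    then obtain z where "z \<in> Z \<inter> U" "\<phi> ?x = \<phi> z"
      using chart(8) by blast
    then show "?x \<in> Z"
      using chart(4) U by (metis IntD1 IntD2 homeomorphism_apply1)
  qed
  have Z: "Pr (x - p) \<in> W" "\<sigma> (Pr (x - p)) = x" if "x \<in> Z" "x \<in> U'" for x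
    using hom(1,2)[OF that(2)] \<Phi>_Z[OF that] by simp_all
  show thesis
  proof (rule that[OF \<sigma>(1,3,4) _ \<sigma>(7)])
    show "\<sigma> 0 = p" "0 \<in> W" "has_complex_derivative \<sigma> (\<lambda>x. x) 0"
      using hom(1)[OF \<sigma>(3)] \<sigma>(5,8) \<open>\<Phi> p = 0\<close> by auto
  qed (fact proj Z)+
qed

section \<open>Real points\<close>

definition complex_vec :: "real ^ 'n \<Rightarrow> complex ^ 'n" where
  "complex_vec x = (\<chi> i. complex_of_real (x $ i))"

definition Re_vec :: "complex ^ 'n \<Rightarrow> real ^ 'n" where
  "Re_vec z = (\<chi> i. Re (z $ i))"

definition Im_vec :: "complex ^ 'n \<Rightarrow> real ^ 'n" where
  "Im_vec z = (\<chi> i. Im (z $ i))"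

definition cnj_vec :: "complex ^ 'n \<Rightarrow> complex ^ 'n" where
  "cnj_vec z = (\<chi> i. cnj (z $ i))"

lemmas vec_parts_defs = complex_vec_def Re_vec_def Im_vec_def cnj_vec_def

lemma linear_complex_vec: "linear (complex_vec :: real ^ 'n::finite \<Rightarrow> _)"
  by (rule linearI) (simp_all add: vec_eq_iff vec_parts_defs scaleR_conv_of_real[where 'a = complex])

lemma linear_Re_vec: "linear (Re_vec :: complex ^ 'n::finite \<Rightarrow> _)"
  by (rule linearI) (simp_all add: vec_eq_iff vec_parts_defs)

lemma linear_Im_vec: "linear (Im_vec :: complex ^ 'n::finite \<Rightarrow> _)"
  by (rule linearI) (simp_all add: vec_eq_iff vec_parts_defs)

lemma linear_cnj_vec: "linear (cnj_vec :: complex ^ 'n::finite \<Rightarrow> _)"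
  by (rule linearI) (simp_all add: vec_eq_iff vec_parts_defs)

lemmas bounded_linear_complex_vec = linear_complex_vec[unfolded linear_conv_bounded_linear]
lemmas bounded_linear_Re_vec = linear_Re_vec[unfolded linear_conv_bounded_linear]
lemmas bounded_linear_cnj_vec = linear_cnj_vec[unfolded linear_conv_bounded_linear]

lemma vec_parts_simps [simp]:
  "Re_vec (complex_vec x) = x" "Im_vec (complex_vec x) = 0" "cnj_vec (complex_vec x) = complex_vec x"
  "Re_vec (cnj_vec z) = Re_vec z" "Im_vec (cnj_vec z) = - Im_vec z"
  "Re_vec (\<i> *s z) = - Im_vec z" "Im_vec (\<i> *s z) = Re_vec z"
  by (simp_all add: vec_eq_iff vec_parts_defs)

lemma complex_vec_Re_Im: "z = complex_vec (Re_vec z) + \<i> *s complex_vec (Im_vec z)"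
  by (simp add: vec_eq_iff vec_parts_defs complex_eq_iff)

lemma complex_vec_eqI: "Re_vec w = Re_vec z \<Longrightarrow> Im_vec w = Im_vec z \<Longrightarrow> w = z"
  using complex_vec_Re_Im by metis

lemma cnj_vec_fixed: "cnj_vec z = z \<Longrightarrow> complex_vec (Re_vec z) = z"
  by (simp add: vec_eq_iff vec_parts_defs complex_eq_iff)

lemma continuous_on_vec_parts:
  "continuous_on S (complex_vec :: real ^ 'n::finite \<Rightarrow> _)"
  "continuous_on S' (cnj_vec :: complex ^ 'n::finite \<Rightarrow> _)"
  using bounded_linear_complex_vec bounded_linear_cnj_vec linear_continuous_on by blast+

section \<open>Scalar extension of real linear maps, and real forms of conjugation-invariant
  subspaces\<close>

definition complexify_map :: "(real ^ 'n \<Rightarrow> real ^ 'm) \<Rightarrow> complex ^ 'n \<Rightarrow> complex ^ 'm" where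
  "complexify_map \<pi> z = complex_vec (\<pi> (Re_vec z)) + \<i> *s complex_vec (\<pi> (Im_vec z))"

lemma Re_Im_complexify_map [simp]:
  fixes \<pi> :: "real ^ 'n::finite \<Rightarrow> real ^ 'm::finite"
  shows "Re_vec (complexify_map \<pi> z) = \<pi> (Re_vec z)" "Im_vec (complexify_map \<pi> z) = \<pi> (Im_vec z)"
  by (simp_all add: complexify_map_def linear_add linear_Re_vec linear_Im_vec)

text \<open>The map is the scalar extension of \<open>\<pi>\<close>. It turns a real projection onto
  the real points of an invariant complex subspace into a complex linear projection onto that
  subspace.\<close>

lemma complex_linear_complexify_map:
  fixes \<pi> :: "real ^ 'n::finite \<Rightarrow> real ^ 'm::finite"
  assumes "linear \<pi>"
  shows "complex_linear (complexify_map \<pi>)"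
proof -
  have scale: "Re_vec (c *s z) = Re c *\<^sub>R Re_vec z - Im c *\<^sub>R Im_vec z"
    "Im_vec (c *s z) = Re c *\<^sub>R Im_vec z + Im c *\<^sub>R Re_vec z"
    for c and z :: "complex ^ 'k::finite"
    by (simp_all add: vec_eq_iff vec_parts_defs)
  have "complexify_map \<pi> (c *s z) = c *s complexify_map \<pi> z" for c z
    by (rule complex_vec_eqI) (simp_all add: scale linear_add linear_diff linear_scale assms)
  moreover have "linear (complexify_map \<pi>)"
    by (rule linearI; rule complex_vec_eqI)
       (simp_all add: linear_add linear_scale assms linear_Re_vec linear_Im_vec)
  ultimately show ?thesis
    by (simp add: complex_linear_def)
qed

lemma complexify_map_complex_vec:
  fixes \<pi> :: "real ^ 'n::finite \<Rightarrow> real ^ 'm::finite"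
  shows "linear \<pi> \<Longrightarrow> complexify_map \<pi> (complex_vec x) = complex_vec (\<pi> x)"
  by (rule complex_vec_eqI) (simp_all add: linear_0)

lemma complexify_map_cnj_vec:
  fixes \<pi> :: "real ^ 'n::finite \<Rightarrow> real ^ 'm::finite"
  assumes "linear \<pi>"
  shows "complexify_map \<pi> (cnj_vec z) = cnj_vec (complexify_map \<pi> z)"
  by (rule complex_vec_eqI) (simp_all add: linear_neg assms)

text \<open>The real part of \<open>z\<close> is the average of \<open>z\<close> and its
  conjugate.\<close>

lemma Re_vec_in_conjugation_invariant:
  fixes T :: "(complex ^ 'n::finite) set"
  assumes T: "vec.subspace T" "\<And>z. z \<in> T \<Longrightarrow> cnj_vec z \<in> T" and "z \<in> T"
  shows "complex_vec (Re_vec z) \<in> T"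
proof -
  have "(1/2) *s (z + cnj_vec z) \<in> T"
    using assms by (intro vec.subspace_scale vec.subspace_add)
  moreover have "(1/2) *s (z + cnj_vec z) = complex_vec (Re_vec z)"
    by (simp add: vec_eq_iff vec_parts_defs complex_eq_iff)
  ultimately show ?thesis
    by simp
qed

text \<open>The imaginary part of \<open>z\<close> is the real part of \<open>- \<i> *s z\<close>.
  Hence \<open>T\<close> is the complexification of its real points.\<close>

lemma conjugation_invariant_iff:
  fixes T :: "(complex ^ 'n::finite) set"
  assumes T: "vec.subspace T" "\<And>z. z \<in> T \<Longrightarrow> cnj_vec z \<in> T"
  shows "z \<in> T \<longleftrightarrow> complex_vec (Re_vec z) \<in> T \<and> complex_vec (Im_vec z) \<in> T"
proof
  assume "z \<in> T"
  then have "(- \<i>) *s z \<in> T"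
    using T(1) vec.subspace_scale by blast
  moreover have "Re_vec ((- \<i>) *s z) = Im_vec z"
    by (simp add: vec_eq_iff vec_parts_defs)
  ultimately show "complex_vec (Re_vec z) \<in> T \<and> complex_vec (Im_vec z) \<in> T"
    using Re_vec_in_conjugation_invariant[OF T] \<open>z \<in> T\<close> by metis
next
  assume "complex_vec (Re_vec z) \<in> T \<and> complex_vec (Im_vec z) \<in> T"
  then show "z \<in> T"
    using complex_vec_Re_Im[of z] T(1) vec.subspace_add vec.subspace_scale by metis
qed

lemma subspace_real_points:
  "vec.subspace T \<Longrightarrow> subspace {v. complex_vec v \<in> (T :: (complex ^ 'n::finite) set)}"
  using complex_subspace_imp_subspace[of T]
  by (auto simp: subspace_def linear_0 linear_add linear_scale linear_complex_vec)

text \<open>A real basis of the real points is a complex basis of \<open>T\<close>: the real and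
  imaginary parts of a complex linear relation among real vectors are real relations, and the real
  and imaginary parts of elements of \<open>T\<close> span \<open>T\<close>.\<close>

lemma dim_real_points:
  fixes T :: "(complex ^ 'n::finite) set"
  assumes T: "vec.subspace T" "\<And>z. z \<in> T \<Longrightarrow> cnj_vec z \<in> T"
  shows "dim {v. complex_vec v \<in> T} = vec.dim T"
proof -
  let ?R = "{v. complex_vec v \<in> T}"
  obtain B where B: "B \<subseteq> ?R" "independent B" "?R \<subseteq> span B" "card B = dim ?R"
    using basis_exists by blast
  have "finite B"
    using B(2) independent_imp_finite by blast
  have inj: "inj_on complex_vec B"
    by (metis inj_onI vec_parts_simps(1))
  have "vec.independent (complex_vec ` B)"
  proof (rule vec.independent_if_scalars_zero)
    show "finite (complex_vec ` B)"
      using \<open>finite B\<close> by simp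
    fix f :: "complex ^ 'n \<Rightarrow> complex" and x
    assume f: "(\<Sum>x\<in>complex_vec ` B. f x *s x) = 0" and x: "x \<in> complex_vec ` B"
    have sum0: "(\<Sum>b\<in>B. f (complex_vec b) *s complex_vec b) = 0"
      using f by (simp add: sum.reindex[OF inj])
    have "Re_vec (\<Sum>b\<in>B. f (complex_vec b) *s complex_vec b) = (\<Sum>b\<in>B. Re (f (complex_vec b)) *\<^sub>R b)"
      by (simp add: linear_sum[OF linear_Re_vec] vec_eq_iff vec_parts_defs)
    then have re: "(\<Sum>b\<in>B. Re (f (complex_vec b)) *\<^sub>R b) = 0"
      by (simp add: sum0 linear_0[OF linear_Re_vec])
    have "Im_vec (\<Sum>b\<in>B. f (complex_vec b) *s complex_vec b) = (\<Sum>b\<in>B. Im (f (complex_vec b)) *\<^sub>R b)"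
      by (simp add: linear_sum[OF linear_Im_vec] vec_eq_iff vec_parts_defs)
    then have im: "(\<Sum>b\<in>B. Im (f (complex_vec b)) *\<^sub>R b) = 0"
      by (simp add: sum0 linear_0[OF linear_Im_vec])
    obtain b where "b \<in> B" "x = complex_vec b"
      using x by blast
    then show "f x = 0"
      using independentD[OF B(2) \<open>finite B\<close> subset_refl re] independentD[OF B(2) \<open>finite B\<close> subset_refl im]
      by (simp add: complex_eq_iff)
  qed
  moreover have "vec.span (complex_vec ` B) = vec.span T"
  proof
    show "vec.span (complex_vec ` B) \<subseteq> vec.span T"
      using B(1) by (intro vec.span_mono) auto
    have sub: "subspace {v. complex_vec v \<in> vec.span (complex_vec ` B)}"
      by (rule subspace_real_points) simp
    have "B \<subseteq> {v. complex_vec v \<in> vec.span (complex_vec ` B)}"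
      by (auto intro: vec.span_base)
    then have "?R \<subseteq> {v. complex_vec v \<in> vec.span (complex_vec ` B)}"
      using B(3) span_minimal[OF _ sub] by blast
    then have "z \<in> vec.span (complex_vec ` B)" if "z \<in> T" for z
      using conjugation_invariant_iff[OF T, of z] that complex_vec_Re_Im[of z]
        vec.span_add vec.span_scale by (metis (mono_tags, lifting) mem_Collect_eq subsetD)
    then show "vec.span T \<subseteq> vec.span (complex_vec ` B)"
      by (intro vec.span_minimal) auto
  qed
  ultimately have "vec.dim T = card (complex_vec ` B)"
    using vec.dim_eq_card by blast
  then show ?thesis
    using B(4) card_image[OF inj] by simp
qed

text \<open>Real counterpart of the complex graph, in the form that
  \<open>smooth_submanifold_graph\<close> takes as input. The identity derivative at 0 will make
  each real tangent vector the velocity of a curve of real points.\<close>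

lemma real_points_graph:
  fixes Z :: "(complex ^ 'n::finite) set"
  assumes Z: "complex_submanifold d Z" "complex_vec x0 \<in> Z" and cnj: "\<And>z. z \<in> Z \<Longrightarrow> cnj_vec z \<in> Z"
    and \<pi>: "linear \<pi>" "\<And>v. complex_vec (\<pi> v) \<in> tangent_space Z (complex_vec x0)"
      "\<And>v. complex_vec v \<in> tangent_space Z (complex_vec x0) \<Longrightarrow> \<pi> v = v"
  obtains U W s where "open U" "x0 \<in> U" "open W" "0 \<in> W" "smooth_on W s"
    "(s has_derivative (\<lambda>x. x)) (at 0)" "s 0 = x0"
    "\<And>y. y \<in> W \<Longrightarrow> \<pi> y = y \<Longrightarrow> complex_vec (s y) \<in> Z" "\<And>y. y \<in> W \<Longrightarrow> \<pi> y = y \<Longrightarrow> \<pi> (s y - x0) = y"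
    "\<And>x. complex_vec x \<in> Z \<Longrightarrow> x \<in> U \<Longrightarrow> \<pi> (x - x0) \<in> W"
    "\<And>x. complex_vec x \<in> Z \<Longrightarrow> x \<in> U \<Longrightarrow> s (\<pi> (x - x0)) = x"
proof -
  let ?T = "tangent_space Z (complex_vec x0)" and ?p = "complex_vec x0" and ?Pr = "complexify_map \<pi>"
  have T: "vec.subspace ?T"
    using complex_submanifold_tangent_space(1)[OF Z] .
  have T_cnj: "cnj_vec z \<in> ?T" if "z \<in> ?T" for z
    using tangent_space_bounded_linear_image[OF bounded_linear_cnj_vec cnj that] by simp
  have Pr: "?Pr z \<in> ?T" "z \<in> ?T \<Longrightarrow> ?Pr z = z" for z
    using \<pi>(2,3) conjugation_invariant_iff[OF T T_cnj, of z] conjugation_invariant_iff[OF T T_cnj, of "?Pr z"]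
    by (auto intro: complex_vec_eqI)
  obtain U W \<sigma> where \<sigma>: "open U" "?p \<in> U" "open W" "0 \<in> W" "complex_differentiable_on W \<sigma>"
    "has_complex_derivative \<sigma> (\<lambda>x. x) 0" "\<sigma> 0 = ?p"
    "\<And>y. y \<in> W \<Longrightarrow> ?Pr y = y \<Longrightarrow> \<sigma> y \<in> Z" "\<And>y. y \<in> W \<Longrightarrow> ?Pr y = y \<Longrightarrow> ?Pr (\<sigma> y - ?p) = y"
    "\<And>x. x \<in> Z \<Longrightarrow> x \<in> U \<Longrightarrow> ?Pr (x - ?p) \<in> W" "\<And>x. x \<in> Z \<Longrightarrow> x \<in> U \<Longrightarrow> \<sigma> (?Pr (x - ?p)) = x"
    by (rule complex_submanifold_graph[OF Z complex_linear_complexify_map[OF \<pi>(1)] Pr])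
       (assumption | rule that)+
  define U' where "U' = complex_vec -` U"
  \<comment> \<open>The conjugate of a point of the graph must lie in \<open>U\<close> as well,
    since \<open>\<sigma>\<close> recovers points of \<open>Z\<close> from their projections only
    there.\<close>
  define W' where "W' = complex_vec -` (W \<inter> (\<lambda>y. cnj_vec (\<sigma> y)) -` U)"
  \<comment> \<open>For \<open>y\<close> outside \<open>range \<pi>\<close> the value of
    \<open>\<sigma>\<close> need not be real; taking the real part still gives a smooth real map on
    all of \<open>W'\<close>.\<close>
  define s where "s y = Re_vec (\<sigma> (complex_vec y))" for y
  have Pr_real: "?Pr (complex_vec x) = complex_vec (\<pi> x)" for x
    using complexify_map_complex_vec[OF \<pi>(1)] .
  have diff: "complex_vec x - ?p = complex_vec (x - x0)" for x
    by (simp add: linear_diff[OF linear_complex_vec])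
  \<comment> \<open>The point over a real parameter and its conjugate both lie in \<open>Z\<close>
    and have the same projection, because \<open>?Pr\<close> commutes with conjugation and the
    parameter is real. Recovering both from it shows that they are equal, so the point is
    real.\<close>
  have s: "complex_vec (s y) = \<sigma> (complex_vec y)" if "y \<in> W'" "\<pi> y = y" for y
  proof -
    have y: "complex_vec y \<in> W" "cnj_vec (\<sigma> (complex_vec y)) \<in> U" "?Pr (complex_vec y) = complex_vec y"
      using that by (auto simp: W'_def Pr_real)
    let ?z = "\<sigma> (complex_vec y)"
    have "?Pr (cnj_vec ?z - ?p) = ?Pr (cnj_vec (?z - ?p))"
      by (simp add: linear_diff[OF linear_cnj_vec])
    also have "\<dots> = complex_vec y"
      by (simp add: complexify_map_cnj_vec[OF \<pi>(1)] \<sigma>(9)[OF y(1,3)])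
    finally have "cnj_vec ?z = ?z"
      using \<sigma>(11)[OF cnj[OF \<sigma>(8)[OF y(1,3)]] y(2)] by simp
    then show ?thesis
      unfolding s_def by (rule cnj_vec_fixed)
  qed
  have "open U'"
    unfolding U'_def using open_vimage[OF \<sigma>(1) continuous_on_vec_parts(1)] .
  have "continuous_on W (\<lambda>y. cnj_vec (\<sigma> y))"
    using continuous_on_compose2[OF continuous_on_vec_parts(2)[of UNIV]
        complex_differentiable_on_imp_continuous_on[OF \<sigma>(5)]] by simp
  then have "open (W \<inter> (\<lambda>y. cnj_vec (\<sigma> y)) -` U)"
    using \<sigma>(1,3) by (simp add: continuous_on_open_vimage Int_commute)
  then have "open W'"
    unfolding W'_def by (rule open_vimage[OF _ continuous_on_vec_parts(1)])
  have zero: "complex_vec 0 = 0"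
    by (rule linear_0[OF linear_complex_vec])
  show thesis
  proof (rule that[OF \<open>open U'\<close> _ \<open>open W'\<close>])
    show "x0 \<in> U'" "0 \<in> W'"
      using \<sigma>(2,4,7) by (simp_all add: U'_def W'_def zero)
    show "s 0 = x0"
      by (simp add: s_def zero \<sigma>(7))
    have "smooth_on W (\<lambda>y. Re_vec (\<sigma> y))"
      by (intro smooth_on_bounded_linear[OF bounded_linear_Re_vec \<sigma>(3)]
          complex_differentiable_on_imp_smooth_on \<sigma>)
    then have "smooth_on {y. 0 + complex_vec y \<in> W} (\<lambda>y. Re_vec (\<sigma> (0 + complex_vec y)))"
      by (rule smooth_on_compose_affine[OF bounded_linear_complex_vec \<sigma>(3)])
    then show "smooth_on W' s"
      unfolding s_def W'_def by (simp add: smooth_on_subset subset_iff)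
    have "(\<sigma> has_derivative (\<lambda>x. x)) (at (complex_vec 0))"
      using \<sigma>(6) by (simp add: has_complex_derivative_def zero)
    then have "((\<lambda>y. Re_vec (\<sigma> (complex_vec y))) has_derivative (\<lambda>y. Re_vec (complex_vec y))) (at 0)"
      using has_derivative_compose[OF bounded_linear_imp_has_derivative[OF bounded_linear_complex_vec]]
      by (intro bounded_linear.has_derivative[OF bounded_linear_Re_vec]) blast
    then show "(s has_derivative (\<lambda>x. x)) (at 0)"
      by (simp add: s_def[abs_def])
  next
    fix y assume y: "y \<in> W'" "\<pi> y = y"
    then have "complex_vec y \<in> W" "?Pr (complex_vec y) = complex_vec y"
      by (auto simp: W'_def Pr_real)
    then show "complex_vec (s y) \<in> Z" "\<pi> (s y - x0) = y"
      using \<sigma>(8,9) s[OF y] by (simp, metis Pr_real diff vec_parts_simps(1))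
  next
    fix x assume x: "complex_vec x \<in> Z" "x \<in> U'"
    then have "complex_vec x \<in> U"
      by (simp add: U'_def)
    then have "complex_vec (\<pi> (x - x0)) \<in> W" "\<sigma> (complex_vec (\<pi> (x - x0))) = complex_vec x"
      using \<sigma>(10,11)[OF x(1)] by (simp_all add: diff Pr_real)
    then show "\<pi> (x - x0) \<in> W'" "s (\<pi> (x - x0)) = x"
      using \<open>complex_vec x \<in> U\<close> by (simp_all add: W'_def s_def)
  qed
qed

lemma real_points_projection:
  fixes T :: "(complex ^ 'n::finite) set"
  assumes "vec.subspace T"
  obtains \<pi> where "linear \<pi>" "\<And>v. complex_vec (\<pi> v) \<in> T" "\<And>v. complex_vec v \<in> T \<Longrightarrow> \<pi> v = v"
  using subspace_projection[OF subspace_real_points[OF assms]] by auto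

text \<open>The model subspace \<open>range \<pi>\<close> is the real form of the complex tangent
  space, so its real dimension equals the complex dimension \<open>d\<close>.\<close>

lemma smooth_submanifold_real_points:
  fixes Z :: "(complex ^ 'n::finite) set"
  assumes Z: "complex_submanifold d Z" and cnj: "\<And>z. z \<in> Z \<Longrightarrow> cnj_vec z \<in> Z"
  shows "smooth_submanifold d {x. complex_vec x \<in> Z}"
  unfolding smooth_submanifold_def
proof
  fix x0 assume "x0 \<in> {x. complex_vec x \<in> Z}"
  then have x0: "complex_vec x0 \<in> Z"
    by simp
  let ?T = "tangent_space Z (complex_vec x0)" and ?M = "{x. complex_vec x \<in> Z}"
  have T: "vec.subspace ?T" "vec.dim ?T = d"
    using complex_submanifold_tangent_space[OF Z x0] by auto
  have T_cnj: "cnj_vec z \<in> ?T" if "z \<in> ?T" for z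
    using tangent_space_bounded_linear_image[OF bounded_linear_cnj_vec cnj that] by simp
  obtain \<pi> where \<pi>: "linear \<pi>" "\<And>v. complex_vec (\<pi> v) \<in> ?T" "\<And>v. complex_vec v \<in> ?T \<Longrightarrow> \<pi> v = v"
    using real_points_projection[OF T(1)] by blast
  obtain U W s where s: "open U" "x0 \<in> U" "open W" "0 \<in> W" "smooth_on W s"
    "(s has_derivative (\<lambda>x. x)) (at 0)" "s 0 = x0"
    "\<And>y. y \<in> W \<Longrightarrow> \<pi> y = y \<Longrightarrow> complex_vec (s y) \<in> Z" "\<And>y. y \<in> W \<Longrightarrow> \<pi> y = y \<Longrightarrow> \<pi> (s y - x0) = y"
    "\<And>x. complex_vec x \<in> Z \<Longrightarrow> x \<in> U \<Longrightarrow> \<pi> (x - x0) \<in> W"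
    "\<And>x. complex_vec x \<in> Z \<Longrightarrow> x \<in> U \<Longrightarrow> s (\<pi> (x - x0)) = x"
    by (rule real_points_graph[OF Z x0 cnj \<pi>]) (assumption | rule that)+
  have range: "range \<pi> = {v. complex_vec v \<in> ?T}"
    using \<pi>(2,3) by (auto simp: image_iff) metis
  have "dim (range \<pi>) = d" "subspace (range \<pi>)"
    unfolding range using dim_real_points[OF T(1) T_cnj] subspace_real_points[OF T(1)] T(2) by simp_all
  moreover have "\<exists>U (V :: (real ^ 'n) set) \<phi> \<psi>. open U \<and> x0 \<in> U \<and> open V \<and> homeomorphism U V \<phi> \<psi> \<and>
      smooth_on U \<phi> \<and> smooth_on V \<psi> \<and> \<phi> ` (?M \<inter> U) = range \<pi> \<inter> V"
    using \<pi> s by (intro smooth_submanifold_graph[OF s(1-5) \<pi>(1)]) auto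
  ultimately show "\<exists>U (V :: (real ^ 'n) set) \<phi> \<psi> L. open U \<and> x0 \<in> U \<and> open V \<and>
      homeomorphism U V \<phi> \<psi> \<and> smooth_on U \<phi> \<and> smooth_on V \<psi> \<and> subspace L \<and> dim L = d \<and>
      \<phi> ` (?M \<inter> U) = L \<inter> V"
    by blast
qed

text \<open>One inclusion pushes curves forward along \<open>complex_vec\<close>. For the other, a
  real vector \<open>v\<close> of the complex tangent space is fixed by \<open>\<pi>\<close>, so
  \<open>s\<close> sends multiples of \<open>v\<close> to real points of \<open>Z\<close>; this
  curve has velocity \<open>v\<close> at \<open>x0\<close>.\<close>

lemma tangent_space_real_points:
  fixes Z :: "(complex ^ 'n::finite) set"
  assumes Z: "complex_submanifold d Z" "complex_vec x0 \<in> Z" and cnj: "\<And>z. z \<in> Z \<Longrightarrow> cnj_vec z \<in> Z"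
  shows "tangent_space {x. complex_vec x \<in> Z} x0 = {v. complex_vec v \<in> tangent_space Z (complex_vec x0)}"
proof (intro equalityI subsetI CollectI)
  fix v assume "v \<in> tangent_space {x. complex_vec x \<in> Z} x0"
  then show "complex_vec v \<in> tangent_space Z (complex_vec x0)"
    by (rule tangent_space_bounded_linear_image[OF bounded_linear_complex_vec, rotated]) simp
next
  let ?T = "tangent_space Z (complex_vec x0)"
  fix v assume "v \<in> {v. complex_vec v \<in> ?T}"
  obtain \<pi> where \<pi>: "linear \<pi>" "\<And>v. complex_vec (\<pi> v) \<in> ?T" "\<And>v. complex_vec v \<in> ?T \<Longrightarrow> \<pi> v = v"
    using real_points_projection[OF complex_submanifold_tangent_space(1)[OF Z]] by blast
  obtain U W s where s: "open U" "x0 \<in> U" "open W" "0 \<in> W" "smooth_on W s"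
    "(s has_derivative (\<lambda>x. x)) (at 0)" "s 0 = x0"
    "\<And>y. y \<in> W \<Longrightarrow> \<pi> y = y \<Longrightarrow> complex_vec (s y) \<in> Z" "\<And>y. y \<in> W \<Longrightarrow> \<pi> y = y \<Longrightarrow> \<pi> (s y - x0) = y"
    "\<And>x. complex_vec x \<in> Z \<Longrightarrow> x \<in> U \<Longrightarrow> \<pi> (x - x0) \<in> W"
    "\<And>x. complex_vec x \<in> Z \<Longrightarrow> x \<in> U \<Longrightarrow> s (\<pi> (x - x0)) = x"
    by (rule real_points_graph[OF Z cnj \<pi>]) (assumption | rule that)+
  have "\<pi> v = v"
    using \<pi>(3) \<open>v \<in> {v. complex_vec v \<in> ?T}\<close> by simp
  then have "s (0 + t *\<^sub>R v) \<in> {x. complex_vec x \<in> Z}" if "0 + t *\<^sub>R v \<in> W" for t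
    using s(8)[OF that] by (simp add: linear_scale[OF \<pi>(1)])
  then have "v \<in> tangent_space {x. complex_vec x \<in> Z} (s 0)"
    using tangent_spaceI_affine[OF s(3,5,4,6)] by blast
  then show "v \<in> tangent_space {x. complex_vec x \<in> Z} x0"
    by (simp add: s(7))
qed

section \<open>Polynomial maps\<close>

lemma lookup_complexify:
  "Poly_Mapping.lookup (complexify p) m = complex_of_real (Poly_Mapping.lookup p m)"
  by (auto simp: complexify_def Poly_Mapping.map.rep_eq when_def)

lemma keys_complexify: "Poly_Mapping.keys (complexify p) = Poly_Mapping.keys p"
  by (auto simp: in_keys_iff lookup_complexify)

lemma poly_eval_complexify_complex_vec:
  "poly_eval (complexify p) (complex_vec x) = complex_of_real (poly_eval p x)"
  by (simp add: poly_eval_def keys_complexify lookup_complexify complex_vec_def)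

text \<open>Conjugation is a ring homomorphism fixing the real coefficients; this makes the complex
  zero loci and their differences invariant.\<close>

lemma poly_eval_complexify_cnj_vec:
  "poly_eval (complexify p) (cnj_vec z) = cnj (poly_eval (complexify p) z)"
  by (simp add: poly_eval_def keys_complexify lookup_complexify cnj_vec_def)

lemma complex_vec_in_complex_zero_locus [simp]:
  "complex_vec x \<in> complex_zero_locus P \<longleftrightarrow> x \<in> zero_locus P"
  by (simp add: complex_zero_locus_def zero_locus_def poly_eval_complexify_complex_vec)

lemma cnj_vec_in_complex_zero_locus [simp]:
  "cnj_vec z \<in> complex_zero_locus P \<longleftrightarrow> z \<in> complex_zero_locus P"
  by (simp add: complex_zero_locus_def zero_locus_def poly_eval_complexify_cnj_vec)

lemma complex_poly_map_complex_vec: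
  "complex_poly_map f (complex_vec x) = complex_vec (poly_map f x)"
  by (simp add: complex_poly_map_def poly_map_def vec_eq_iff poly_eval_complexify_complex_vec)
     (simp add: complex_vec_def)

lemma poly_eval_has_derivative:
  fixes q :: "('n::finite, complex) mpoly"
  shows "\<exists>D. (poly_eval q has_derivative D) (at z) \<and> (\<forall>c v. D (c *s v) = c * D v)"
proof -
  \<comment> \<open>Product rule over the variables with the power rule in each. For exponent 0 the
    subtraction truncates to 0, and the factor \<open>of_nat 0\<close> removes the term.\<close>
  define E where "E m v = (\<Sum>i\<in>UNIV. of_nat (Poly_Mapping.lookup m i) * v $ i *
      z $ i ^ (Poly_Mapping.lookup m i - 1) * (\<Prod>j\<in>UNIV - {i}. z $ j ^ Poly_Mapping.lookup m j))"
    for m and v :: "complex ^ 'n"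
  have "((\<lambda>z. \<Prod>i\<in>UNIV. z $ i ^ Poly_Mapping.lookup m i) has_derivative E m) (at z)"
    for m :: "'n \<Rightarrow>\<^sub>0 nat"
    unfolding E_def
    by (intro has_derivative_prod has_derivative_power bounded_linear_imp_has_derivative
        bounded_linear_vec_nth)
  then have "(poly_eval q has_derivative
      (\<lambda>v. \<Sum>m\<in>Poly_Mapping.keys q. Poly_Mapping.lookup q m * E m v)) (at z)"
    unfolding poly_eval_def[abs_def] by (intro has_derivative_sum has_derivative_mult_right)
  moreover have "E m (c *s v) = c * E m v" for m c v
    by (simp add: E_def sum_distrib_left mult_ac)
  ultimately show ?thesis
    by (intro exI conjI) (auto simp: sum_distrib_left mult_ac)
qed

lemma complex_poly_map_has_complex_derivative:
  fixes f :: "('n::finite, real) mpoly ^ 'm::finite"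
  obtains D where "has_complex_derivative (complex_poly_map f) D z"
proof -
  have "\<forall>j. \<exists>D. (poly_eval (complexify (f $ j)) has_derivative D) (at z) \<and>
      (\<forall>c v. D (c *s v) = c * D v)"
    using poly_eval_has_derivative by blast
  from choice[OF this] obtain E
    where E: "\<And>j. (poly_eval (complexify (f $ j)) has_derivative E j) (at z)"
      "\<And>j c v. E j (c *s v) = c * E j v"
    by blast
  have "(complex_poly_map f has_derivative (\<lambda>v. \<chi> j. E j v)) (at z)"
    by (rule has_derivative_vec_lambda) (simp add: complex_poly_map_def poly_map_def E(1))
  moreover have "linear (\<lambda>v. \<chi> j. E j v)"
    using calculation has_derivative_linear by blast
  ultimately show thesis
    by (intro that[of "\<lambda>v. \<chi> j. E j v"])
       (simp add: has_complex_derivative_def complex_linear_def E(2) vec_eq_iff)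
qed

lemma poly_map_eq: "poly_map f x = Re_vec (complex_poly_map f (complex_vec x))"
  by (simp add: complex_poly_map_complex_vec)

text \<open>Smoothness is inherited from the complex polynomial map, which is complex differentiable
  everywhere: restrict it to real vectors and take real parts.\<close>

lemma smooth_on_poly_map:
  fixes f :: "('n::finite, real) mpoly ^ 'm::finite"
  shows "smooth_on UNIV (poly_map f)"
proof -
  have "complex_differentiable_on UNIV (complex_poly_map f)"
    unfolding complex_differentiable_on_iff using complex_poly_map_has_complex_derivative by metis
  then have "smooth_on UNIV (\<lambda>z. Re_vec (complex_poly_map f z))"
    by (rule smooth_on_bounded_linear[OF bounded_linear_Re_vec open_UNIV
          complex_differentiable_on_imp_smooth_on[OF open_UNIV]])
  then have "smooth_on {x. 0 + complex_vec x \<in> UNIV} (\<lambda>x. Re_vec (complex_poly_map f (0 + complex_vec x)))"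
    by (rule smooth_on_compose_affine[OF bounded_linear_complex_vec open_UNIV])
  then show ?thesis
    by (simp add: poly_map_eq[abs_def])
qed

text \<open>Invariance under conjugation is assumed for \<open>Z\<close> and \<open>W\<close>, while
  surjectivity is given on the components \<open>M'\<close> and \<open>N'\<close>. Passing between a
  set and its component does not change tangent spaces, so the two kinds of information can be
  combined.\<close>

lemma smooth_submersion_real_points:
  fixes f :: "('n::finite, real) mpoly ^ 'm::finite"
  assumes Z: "complex_submanifold d Z" "\<And>z. z \<in> Z \<Longrightarrow> cnj_vec z \<in> Z"
    and W: "complex_submanifold e W" "\<And>z. z \<in> W \<Longrightarrow> cnj_vec z \<in> W"
    and comp: "M' \<in> components Z" "N' \<in> components W"
      "M \<in> components {x. complex_vec x \<in> Z}" "N \<in> components {y. complex_vec y \<in> W}"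
    and sub: "complex_vec ` M \<subseteq> M'" "poly_map f ` M \<subseteq> N"
    and f: "smooth_submersion M' N' (complex_poly_map f)"
  shows "smooth_submersion M N (poly_map f)"
  unfolding smooth_submersion_def
proof (intro conjI ballI)
  show "\<exists>d. smooth_submanifold d M" "\<exists>e. smooth_submanifold e N"
    using smooth_submanifold_component comp(3,4) smooth_submanifold_real_points Z W by blast+
  show "poly_map f ` M \<subseteq> N"
    by (rule sub)
next
  fix x assume x: "x \<in> M"
  let ?p = "complex_vec x" and ?q = "complex_vec (poly_map f x)"
  have p: "?p \<in> M'" "?p \<in> Z"
    using x sub(1) in_components_subset[OF comp(1)] by auto
  have q: "?q \<in> N'" "?q \<in> W" "poly_map f x \<in> N"
    using p(1) f x sub(2) in_components_subset[OF comp(2)] complex_poly_map_complex_vec[of f x]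
    by (auto simp: smooth_submersion_def image_subset_iff)
  obtain D where D: "has_complex_derivative (complex_poly_map f) D ?p"
    by (rule complex_poly_map_has_complex_derivative)
  then have linD: "complex_linear D" and derivD: "(complex_poly_map f has_derivative D) (at ?p)"
    by (auto simp: has_complex_derivative_def)
  define DR where "DR v = Re_vec (D (complex_vec v))" for v
  have deriv: "((\<lambda>x. complex_poly_map f (complex_vec x)) has_derivative (\<lambda>v. D (complex_vec v))) (at x)"
    using has_derivative_compose[OF bounded_linear_imp_has_derivative[OF bounded_linear_complex_vec] derivD] .
  have derivDR: "(poly_map f has_derivative DR) (at x)"
    using bounded_linear.has_derivative[OF bounded_linear_Re_vec deriv]
    by (simp add: poly_map_eq[abs_def] DR_def[abs_def])
  \<comment> \<open>The same map is differentiated in two ways: \<open>poly_map f\<close> followed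
    by \<open>complex_vec\<close>, and \<open>complex_vec\<close> followed by the complex map.
    Uniqueness of the derivative shows that \<open>D\<close> sends real vectors to real
    vectors.\<close>
  have "((\<lambda>x. complex_vec (poly_map f x)) has_derivative (\<lambda>v. complex_vec (DR v))) (at x)"
    using bounded_linear.has_derivative[OF bounded_linear_complex_vec derivDR] .
  then have "(\<lambda>v. complex_vec (DR v)) = (\<lambda>v. D (complex_vec v))"
    using deriv by (simp add: complex_poly_map_complex_vec has_derivative_unique)
  then have real: "complex_vec (DR v) = D (complex_vec v)" for v
    by meson
  have Re: "Re_vec (D u) = DR (Re_vec u)" for u
  proof -
    have "D u = D (complex_vec (Re_vec u) + \<i> *s complex_vec (Im_vec u))"
      using complex_vec_Re_Im by metis
    also have "\<dots> = complex_vec (DR (Re_vec u)) + \<i> *s complex_vec (DR (Im_vec u))"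
      by (simp only: complex_linear_add[OF linD] complex_linear_scale[OF linD] real)
    finally show ?thesis
      by (simp add: linear_add[OF linear_Re_vec])
  qed
  have TM: "tangent_space M x = {v. complex_vec v \<in> tangent_space Z ?p}"
    using tangent_space_component[OF comp(3) x] tangent_space_real_points[OF Z(1) p(2) Z(2)] by simp
  have TN: "tangent_space N (poly_map f x) = {v. complex_vec v \<in> tangent_space W ?q}"
    using tangent_space_component[OF comp(4) q(3)] tangent_space_real_points[OF W(1) q(2) W(2)] by simp
  have TC: "D ` tangent_space Z ?p = tangent_space W ?q"
    using smooth_submersion_derivative[OF f p(1) derivD] tangent_space_component[OF comp(1) p(1)]
      tangent_space_component[OF comp(2) q(1)] by (simp add: complex_poly_map_complex_vec)
  have "DR ` tangent_space M x = tangent_space N (poly_map f x)"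
  proof (intro equalityI subsetI)
    fix w assume "w \<in> DR ` tangent_space M x"
    then show "w \<in> tangent_space N (poly_map f x)"
      unfolding TM TN using TC real by auto
  next
    fix w assume "w \<in> tangent_space N (poly_map f x)"
    then obtain u where u: "u \<in> tangent_space Z ?p" "complex_vec w = D u"
      using TC by (auto simp: TN)
    have cnj: "cnj_vec z \<in> tangent_space Z ?p" if "z \<in> tangent_space Z ?p" for z
      using tangent_space_bounded_linear_image[OF bounded_linear_cnj_vec Z(2) that] by simp
    have "Re_vec u \<in> tangent_space M x"
      unfolding TM
      using Re_vec_in_conjugation_invariant[OF complex_submanifold_tangent_space(1)[OF Z(1) p(2)] cnj u(1)]
      by simp
    moreover have "w = DR (Re_vec u)"
      using Re u(2) by (metis vec_parts_simps(1))
    ultimately show "w \<in> DR ` tangent_space M x"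
      by blast
  qed
  then show "\<exists>U g D. open U \<and> x \<in> U \<and> smooth_on U g \<and> (\<forall>y\<in>M \<inter> U. g y = poly_map f y) \<and>
      (g has_derivative D) (at x) \<and> D ` tangent_space M x = tangent_space N (poly_map f x)"
    using smooth_on_poly_map derivDR
    by (intro exI[of _ UNIV] exI[of _ "poly_map f"] exI[of _ DR]) auto
qed

section \<open>From the strata of the complex flags to the strata of the real flags\<close>

lemma complex_whitney_flag_stratum:
  assumes flag: "complex_whitney_flag k (\<lambda>i. complex_zero_locus (I i)) X" and "i \<in> {0..k}"
    and Z_def: "Z = complex_zero_locus (I i) - complex_zero_locus (I (i - 1))" and "z \<in> Z"
  shows "complex_submanifold (nat i) Z"
  \<comment> \<open>The flag condition offers an empty difference as an alternative; the point
    \<open>z\<close> excludes it.\<close>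
  using assms unfolding complex_whitney_flag_def by blast

theorem theorem4p5:
  fixes P :: "('n::finite, real) mpoly set"
    and Q :: "('m::finite, real) mpoly set"
    and f :: "('n, real) mpoly ^ 'm"
    and I :: "int \<Rightarrow> ('n, real) mpoly set"
    and J :: "int \<Rightarrow> ('m, real) mpoly set"
    and k l :: int
  assumes f_maps: "poly_map f ` zero_locus P \<subseteq> zero_locus Q"
    and f_complex_maps: "complex_poly_map f ` complex_zero_locus P \<subseteq> complex_zero_locus Q"
    and I_radical: "\<And>i. -1 \<le> i \<Longrightarrow> i \<le> k \<Longrightarrow> radical_ideal (I i)"
    and I_descending: "\<And>i j. -1 \<le> i \<Longrightarrow> i \<le> j \<Longrightarrow> j \<le> k \<Longrightarrow> I j \<subseteq> I i"
    and J_radical: "\<And>i. -1 \<le> i \<Longrightarrow> i \<le> l \<Longrightarrow> radical_ideal (J i)"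
    and J_descending: "\<And>i j. -1 \<le> i \<Longrightarrow> i \<le> j \<Longrightarrow> j \<le> l \<Longrightarrow> J j \<subseteq> J i"
    and X_whitney: "complex_whitney_flag k (\<lambda>i. complex_zero_locus (I i)) (complex_zero_locus P)"
    and Y_whitney: "complex_whitney_flag l (\<lambda>i. complex_zero_locus (J i)) (complex_zero_locus Q)"
    and f_complex_stratified:
      "stratified_map
         (complex_zero_locus P) (flag_strata k (\<lambda>i. complex_zero_locus (I i)))
         (complex_zero_locus Q) (flag_strata l (\<lambda>i. complex_zero_locus (J i)))
         (complex_poly_map f)"
  shows "stratified_map
           (zero_locus P) (flag_strata k (\<lambda>i. zero_locus (I i)))
           (zero_locus Q) (flag_strata l (\<lambda>i. zero_locus (J i)))
           (poly_map f)"
  unfolding stratified_map_def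
proof (intro conjI ballI)
  have cont: "continuous_on A (poly_map f)" for A
    using smooth_on_imp_continuous_on[OF smooth_on_poly_map] continuous_on_subset by blast
  then show "continuous_on (zero_locus P) (poly_map f)" .
  show "poly_map f ` zero_locus P \<subseteq> zero_locus Q"
    by (rule f_maps)
  fix M assume "M \<in> flag_strata k (\<lambda>i. zero_locus (I i))"
  then obtain i where i: "i \<in> {0..k}" and M: "M \<in> components (zero_locus (I i) - zero_locus (I (i - 1)))"
    by (auto simp: flag_strata_def)
  define Z where "Z = complex_zero_locus (I i) - complex_zero_locus (I (i - 1))"
  have ZR: "{x. complex_vec x \<in> Z} = zero_locus (I i) - zero_locus (I (i - 1))"
    by (auto simp: Z_def)
  have Z_cnj: "cnj_vec z \<in> Z" if "z \<in> Z" for z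
    using that by (simp add: Z_def)
  have M_sub: "complex_vec ` M \<subseteq> Z"
    using in_components_subset[OF M] ZR by blast
  obtain x where x: "x \<in> M"
    using in_components_nonempty[OF M] by blast
  then have "complex_vec x \<in> Z"
    using M_sub by blast
  then have Z: "complex_submanifold (nat i) Z"
    using complex_whitney_flag_stratum[OF X_whitney i Z_def] by blast
  \<comment> \<open>The real stratum is connected, so its image under \<open>complex_vec\<close>
    lies in a single complex stratum, the one through \<open>x\<close>.\<close>
  define M' where "M' = connected_component_set Z (complex_vec x)"
  have M': "M' \<in> components Z"
    unfolding M'_def using \<open>complex_vec x \<in> Z\<close> by (rule componentsI)
  have "connected (complex_vec ` M)"
    by (rule connected_continuous_image[OF continuous_on_vec_parts(1) in_components_connected[OF M]])
  then have MM': "complex_vec ` M \<subseteq> M'"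
    unfolding M'_def using x M_sub by (intro connected_component_maximal) auto
  have "M' \<in> flag_strata k (\<lambda>i. complex_zero_locus (I i))"
    unfolding flag_strata_def using i M' by (auto simp: Z_def)
  then obtain N' where N': "N' \<in> flag_strata l (\<lambda>i. complex_zero_locus (J i))"
    "complex_poly_map f ` M' \<subseteq> N'" "smooth_submersion M' N' (complex_poly_map f)"
    using f_complex_stratified unfolding stratified_map_def by blast
  obtain j where j: "j \<in> {0..l}"
    "N' \<in> components (complex_zero_locus (J j) - complex_zero_locus (J (j - 1)))"
    using N'(1) by (auto simp: flag_strata_def)
  define W where "W = complex_zero_locus (J j) - complex_zero_locus (J (j - 1))"
  have WR: "{x. complex_vec x \<in> W} = zero_locus (J j) - zero_locus (J (j - 1))"
    by (auto simp: W_def)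
  have W_cnj: "cnj_vec z \<in> W" if "z \<in> W" for z
    using that by (simp add: W_def)
  have N'W: "N' \<in> components W"
    using j(2) by (simp add: W_def)
  \<comment> \<open>That \<open>f\<close> maps all of \<open>M\<close> into one difference of the
    real flag comes from the complex side: the complex map sends \<open>M'\<close> into
    \<open>N'\<close>, which lies in \<open>W\<close>. The index \<open>j\<close> may differ from
    \<open>i\<close>.\<close>
  have fM: "complex_vec (poly_map f y) \<in> W" if "y \<in> M" for y
    using that MM' N'(2) in_components_subset[OF N'W] complex_poly_map_complex_vec[of f y] by force
  then have W: "complex_submanifold (nat j) W"
    using complex_whitney_flag_stratum[OF Y_whitney j(1) W_def] x by blast
  \<comment> \<open>The real points of \<open>N'\<close> may be disconnected, so the real target
    stratum is the component through \<open>poly_map f x\<close>; it contains the image of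
    \<open>M\<close> because that image is connected.\<close>
  define N where "N = connected_component_set {y. complex_vec y \<in> W} (poly_map f x)"
  have N: "N \<in> components {y. complex_vec y \<in> W}"
    unfolding N_def using fM[OF x] by (intro componentsI) simp
  have fMN: "poly_map f ` M \<subseteq> N"
    unfolding N_def using x fM connected_continuous_image[OF cont in_components_connected[OF M]]
    by (intro connected_component_maximal) auto
  have "smooth_submersion M N (poly_map f)"
    using smooth_submersion_real_points[OF Z Z_cnj W W_cnj M' N'W _ N MM' fMN N'(3)] M ZR by simp
  moreover have "N \<in> flag_strata l (\<lambda>i. zero_locus (J i))"
    unfolding flag_strata_def using j(1) N WR by auto
  ultimately show "\<exists>N\<in>flag_strata l (\<lambda>i. zero_locus (J i)).
      poly_map f ` M \<subseteq> N \<and> smooth_submersion M N (poly_map f)"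
    using fMN by blast
qed

end
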